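(* The following hold, where $\mathrm{e}=2.718\ldots$ is Euler's number: (a) for every integer $k\ge1$, $S_k^{\mathrm{HP}}\le 2\mathrm{e}(k+1)\cdot k^{k/2}$ and $S_k^{\mathrm{ST}}\le 2\mathrm{e}(k+1)\cdot k^{k/2}$; (b) $S_k^{\mathrm{PM}}=k^{k/2}\cdot(1+o_k(1))$, i.e. $S_k^{\mathrm{PM}}/k^{k/2}\to1$ as $k\to\infty$.
   Context: For an edge $e=\mathbf{a}\mathbf{b}$ with $\mathbf{a},\mathbf{b}\in\mathbb{R}^k$, $|e|:=|\mathbf{a}-\mathbf{b}|$ is the Euclidean distance between its endpoints. For a set $E$ of edges of the complete graph on a finite set $X\subseteq\mathbb{R}^k$, $S_k(E):=\sum_{e\in E}|e|^k$. Let $S_k^{\mathrm{HP}}(X)$, $S_k^{\mathrm{ST}}(X)$, $S_k^{\mathrm{PM}}(X)$ be the minimum of $S_k(E)$ over all edge sets $E$ that are, respectively, Hamiltonian paths, spanning trees, perfect matchings of the complete graph on $X$ (for perfect matchings only sets $X$ of even size are considered). Let $S_k^{\mathrm{HP}}$ and $S_k^{\mathrm{ST}}$ be the suprema of $S_k^{\mathrm{HP}}(X)$ and $S_k^{\mathrm{ST}}(X)$ over all finite (nonempty) $X\subseteq[0,1]^k$, and $S_k^{\mathrm{PM}}$ the supremum of $S_k^{\mathrm{PM}}(X)$ over all finite $X\subseteq[0,1]^k$ of even size. *)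

theory Defs
  imports "HOL-Analysis.Analysis"
begin

text \<open>
  The dimension \<open>k\<close> is a variable of the theorem (and tends to infinity in one part of it), so it
  cannot be a type.  Points of $\mathbb{R}^k$ are functions \<open>nat \<Rightarrow> real\<close> that are extensional on
  \<open>{..<k}\<close>, so that distinct functions are distinct points.
\<close>

type_synonym point = "nat \<Rightarrow> real"

definition euclid_dist :: "nat \<Rightarrow> point \<Rightarrow> point \<Rightarrow> real" where
  "euclid_dist k a b = L2_set (\<lambda>i. a i - b i) {..<k}"

definition unit_cube :: "nat \<Rightarrow> point set" where
  "unit_cube k = (\<Pi>\<^sub>E i\<in>{..<k}. {0..1})"

definition complete_edges :: "'a set \<Rightarrow> 'a set set" where
  "complete_edges X = {e. e \<subseteq> X \<and> card e = 2}"

text \<open>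
  Edges are unordered pairs; the value is determined because the distance is symmetric.
\<close>

definition edge_length :: "nat \<Rightarrow> point set \<Rightarrow> real" where
  "edge_length k e = (THE r. \<exists>a b. e = {a, b} \<and> r = euclid_dist k a b)"

lemma euclid_dist_commute: "euclid_dist k a b = euclid_dist k b a"
  by (simp add: euclid_dist_def L2_set_def power2_commute)

lemma edge_length_insert [simp]: "edge_length k {a, b} = euclid_dist k a b"
  unfolding edge_length_def
  by (rule the_equality) (auto simp: doubleton_eq_iff euclid_dist_commute)

definition edge_sum :: "nat \<Rightarrow> point set set \<Rightarrow> real" where
  "edge_sum k E = (\<Sum>e\<in>E. edge_length k e ^ k)"

definition hamiltonian_path :: "'a set \<Rightarrow> 'a set set \<Rightarrow> bool" where
  "hamiltonian_path X E \<longleftrightarrow>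
     (\<exists>xs. distinct xs \<and> set xs = X \<and> E = {{xs ! i, xs ! Suc i} | i. Suc i < length xs})"

definition connected_graph :: "'a set \<Rightarrow> 'a set set \<Rightarrow> bool" where
  "connected_graph X E \<longleftrightarrow> (\<forall>u\<in>X. \<forall>v\<in>X. (u, v) \<in> {(a, b). {a, b} \<in> E}\<^sup>*)"

text \<open>The list enumerates the vertices of a cycle once; its last vertex is joined to the first.\<close>

definition is_cycle :: "'a set set \<Rightarrow> 'a list \<Rightarrow> bool" where
  "is_cycle E vs \<longleftrightarrow> 3 \<le> length vs \<and> distinct vs \<and>
     (\<forall>i<length vs. {vs ! i, vs ! (Suc i mod length vs)} \<in> E)"

definition spanning_tree :: "'a set \<Rightarrow> 'a set set \<Rightarrow> bool" where
  "spanning_tree X E \<longleftrightarrow>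
     E \<subseteq> complete_edges X \<and> connected_graph X E \<and> (\<nexists>vs. is_cycle E vs)"

definition perfect_matching :: "'a set \<Rightarrow> 'a set set \<Rightarrow> bool" where
  "perfect_matching X E \<longleftrightarrow> E \<subseteq> complete_edges X \<and> (\<forall>x\<in>X. \<exists>!e. e \<in> E \<and> x \<in> e)"

text \<open>
  If \<open>X\<close> is finite and nonempty (for paths and trees) or finite of even size (for matchings), then
  \<open>Min\<close> is applied to a finite nonempty set; the suprema below are restricted to such \<open>X\<close>.
\<close>

definition HP_min :: "nat \<Rightarrow> point set \<Rightarrow> real" where
  "HP_min k X = Min (edge_sum k ` {E. hamiltonian_path X E})"

definition ST_min :: "nat \<Rightarrow> point set \<Rightarrow> real" where
  "ST_min k X = Min (edge_sum k ` {E. spanning_tree X E})"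

definition PM_min :: "nat \<Rightarrow> point set \<Rightarrow> real" where
  "PM_min k X = Min (edge_sum k ` {E. perfect_matching X E})"

text \<open>
  The suprema are taken in the extended reals: a supremum in \<open>real\<close> would be an
  unspecified value if the set were unbounded, so finiteness would not be part of the claim.
\<close>

definition HP_sup :: "nat \<Rightarrow> ereal" where
  "HP_sup k = (SUP X\<in>{X. finite X \<and> X \<noteq> {} \<and> X \<subseteq> unit_cube k}. ereal (HP_min k X))"

definition ST_sup :: "nat \<Rightarrow> ereal" where
  "ST_sup k = (SUP X\<in>{X. finite X \<and> X \<noteq> {} \<and> X \<subseteq> unit_cube k}. ereal (ST_min k X))"

definition PM_sup :: "nat \<Rightarrow> ereal" where
  "PM_sup k = (SUP X\<in>{X. finite X \<and> even (card X) \<and> X \<subseteq> unit_cube k}. ereal (PM_min k X))"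

end

(*
  Choose a Hamiltonian path (a perfect matching) minimising the sum of the squared edge lengths
  instead of the k-th powers. Write an edge as m + u, m - u. Exchanging two edges shows that
  |m_i - m_j| >= |u_i + u_j| (for matchings also >= |u_i - u_j|). Summing over all pairs of edges
  with |y - m_i|^2 <= c |u_i|^2 bounds their number by 2 / (1 - c), for every point y and c < 1.
  Hence regions D_i around the m_i with volume about |u_i|^k overlap only boundedly often, and it
  remains to place them into a set of small volume.

  Place the cube with its centre at 0, in the ball B of radius sqrt k / 2, so that
  |m_i|^2 + |u_i|^2 <= k / 4.  For (a), half balls with centre m_i that face the origin stay in B.
  For (b), at most one edge has |u_i|^2 > k / 6 and it contributes at most k^(k/2). Edges of medium
  length get slices of half balls pushed slightly towards the origin, which lie in a strictly
  smaller ball. Short edges get balls that stay near the cube, and the volume of a neighbourhood of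
  the cube is exponentially smaller than that of B. The lower bound in (b) is a diagonal of the
  cube.
*)
theory Submission
  imports Defs "HOL-Real_Asymp.Real_Asymp"
begin

section \<open>Lebesgue measure and the Euclidean norm in variable dimension\<close>

abbreviation leb :: "nat \<Rightarrow> point measure" where
  "leb k \<equiv> PiM {..<k} (\<lambda>_. lborel)"

text \<open>Only coordinates below \<open>k\<close> are read, so sums and differences of points can
  be plain lambda terms although they are not extensional.\<close>

definition nsq :: "nat \<Rightarrow> point \<Rightarrow> real" where
  "nsq k x = (\<Sum>i<k. (x i)\<^sup>2)"

definition inp :: "nat \<Rightarrow> point \<Rightarrow> point \<Rightarrow> real" where
  "inp k x y = (\<Sum>i<k. x i * y i)"

text \<open>No closed form of this volume is used. It cancels between the two sides of a packing
  estimate, or is bounded from below by \<open>ball_volume_ge\<close>.\<close>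

definition unit_vol :: "nat \<Rightarrow> real" where
  "unit_vol k = measure (leb k) {x \<in> space (leb k). nsq k x \<le> 1}"

lemma nsq_nonneg [simp]: "0 \<le> nsq k x"
  unfolding nsq_def by (simp add: sum_nonneg)

lemma nsq_restrict [simp]: "nsq k (restrict f {..<k}) = nsq k f"
  unfolding nsq_def by (rule sum.cong) auto

lemma inp_restrict [simp]: "inp k (restrict f {..<k}) g = inp k f g"
  unfolding inp_def by (rule sum.cong) auto

lemma nsq_add: "nsq k (\<lambda>i. x i + t * y i) = nsq k x + 2 * t * inp k x y + t\<^sup>2 * nsq k y"
  unfolding nsq_def inp_def
  by (simp add: power2_sum sum.distrib sum_distrib_left power_mult_distrib mult_ac)

lemma nsq_scale: "nsq k (\<lambda>i. t * y i) = t\<^sup>2 * nsq k y"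
  unfolding nsq_def by (simp add: sum_distrib_left power_mult_distrib)

lemma inp_cauchy: "(inp k x y)\<^sup>2 \<le> nsq k x * nsq k y"
  unfolding nsq_def inp_def by (rule Cauchy_Schwarz_ineq_sum)

lemma measurable_nsq_diff [measurable]: "(\<lambda>x. nsq k (\<lambda>i. x i - c i)) \<in> borel_measurable (leb k)"
  unfolding nsq_def by measurable

lemma measurable_nsq [measurable]: "nsq k \<in> borel_measurable (leb k)"
  using measurable_nsq_diff[of k "\<lambda>_. 0"] by simp

lemma measurable_inp_diff [measurable]:
  "(\<lambda>x. inp k (\<lambda>i. x i - c i) m) \<in> borel_measurable (leb k)"
  unfolding inp_def by measurable

lemma measurable_inp [measurable]: "(\<lambda>x. inp k x m) \<in> borel_measurable (leb k)"
  using measurable_inp_diff[of k "\<lambda>_. 0"] by simp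

lemma measurable_affine [measurable]:
  "(\<lambda>x. \<lambda>i\<in>{..<k}. c i + t * x i) \<in> measurable (leb k) (leb k)"
  by measurable

text \<open>A product measure is determined by its values on boxes. On a box the one-dimensional
  substitution rule applies in each coordinate, and the factors |t| multiply to |t|^k. Translations,
  dilations and the reflection at the origin are all instances.\<close>

lemma emeasure_leb_affine:
  fixes c :: point and t :: real
  assumes t: "t \<noteq> 0" and A: "A \<in> sets (leb k)"
  shows "emeasure (leb k) A = ennreal (\<bar>t\<bar> ^ k) *
    emeasure (leb k) {x \<in> space (leb k). (\<lambda>i\<in>{..<k}. c i + t * x i) \<in> A}"
proof -
  interpret product_sigma_finite "\<lambda>_::nat. lborel :: real measure"
    by unfold_locales
  define f where "f = (\<lambda>x::point. \<lambda>i\<in>{..<k}. c i + t * x i)"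
  have f [measurable]: "f \<in> measurable (leb k) (leb k)"
    unfolding f_def by (rule measurable_affine)
  define P where "P = scale_measure (ennreal (\<bar>t\<bar> ^ k)) (distr (leb k) (leb k) f)"
  have "P = leb k"
  proof (rule PiM_eqI)
    show "finite {..<k}" by simp
    show "sets P = sets (leb k)" by (simp add: P_def)
    fix B :: "nat \<Rightarrow> real set" assume B: "\<And>i. i \<in> {..<k} \<Longrightarrow> B i \<in> sets lborel"
    have box: "Pi\<^sub>E {..<k} B \<in> sets (leb k)"
      using B by (intro sets_PiM_I_finite) auto
    have pre: "f -` Pi\<^sub>E {..<k} B \<inter> space (leb k) = Pi\<^sub>E {..<k} (\<lambda>i. {x. c i + t * x \<in> B i})"
    proof (rule set_eqI)
      fix x
      show "x \<in> f -` Pi\<^sub>E {..<k} B \<inter> space (leb k) \<longleftrightarrow> x \<in> Pi\<^sub>E {..<k} (\<lambda>i. {x. c i + t * x \<in> B i})"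
        unfolding f_def space_PiM by (simp add: PiE_iff)
    qed
    have B': "{x. c i + t * x \<in> B i} \<in> sets lborel" if "i < k" for i
    proof -
      have "(\<lambda>x. c i + t * x) -` B i \<inter> space borel \<in> sets borel"
        using B[of i] that by (intro measurable_sets[of _ _ borel]) auto
      then show ?thesis by (simp add: vimage_def)
    qed
    have one: "ennreal \<bar>t\<bar> * emeasure lborel {x. c i + t * x \<in> B i} = emeasure lborel (B i)" if "i < k" for i
    proof -
      have "emeasure lborel (B i) = (\<integral>\<^sup>+x. indicator (B i) x \<partial>lborel)"
        using B[of i] that by simp
      also have "\<dots> = ennreal \<bar>t\<bar> * (\<integral>\<^sup>+x. indicator (B i) (c i + t * x) \<partial>lborel)"
        using B[of i] that t by (intro nn_integral_real_affine) auto
      also have "(\<lambda>x. indicator (B i) (c i + t * x)) = (indicator {x. c i + t * x \<in> B i} :: real \<Rightarrow> ennreal)"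
        by (auto simp: indicator_def)
      finally show ?thesis using B'[OF that] by simp
    qed
    have "emeasure P (Pi\<^sub>E {..<k} B) = ennreal (\<bar>t\<bar> ^ k) * emeasure (leb k) (Pi\<^sub>E {..<k} (\<lambda>i. {x. c i + t * x \<in> B i}))"
      using box by (simp add: P_def emeasure_distr pre)
    also have "\<dots> = (\<Prod>i<k. ennreal \<bar>t\<bar>) * (\<Prod>i<k. emeasure lborel {x. c i + t * x \<in> B i})"
      using B' by (subst emeasure_PiM) (auto simp: ennreal_power)
    also have "\<dots> = (\<Prod>i<k. emeasure lborel (B i))"
      unfolding prod.distrib[symmetric] using one by (intro prod.cong) auto
    finally show "emeasure P (Pi\<^sub>E {..<k} B) = (\<Prod>i<k. emeasure lborel (B i))" .
  qed
  then have "emeasure (leb k) A = emeasure P A" by simp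
  also have "\<dots> = ennreal (\<bar>t\<bar> ^ k) * emeasure (leb k) (f -` A \<inter> space (leb k))"
    using A by (simp add: P_def emeasure_distr)
  also have "f -` A \<inter> space (leb k) = {x \<in> space (leb k). (\<lambda>i\<in>{..<k}. c i + t * x i) \<in> A}"
    by (auto simp: f_def)
  finally show ?thesis .
qed

lemma measure_leb_affine:
  fixes c :: point and t :: real
  assumes "t \<noteq> 0" "A \<in> sets (leb k)"
  shows "measure (leb k) A = \<bar>t\<bar> ^ k *
    measure (leb k) {x \<in> space (leb k). (\<lambda>i\<in>{..<k}. c i + t * x i) \<in> A}"
  unfolding measure_def
  by (subst emeasure_leb_affine[OF assms, of c]) (simp add: enn2real_mult)

lemma affine_in_space [simp]: "restrict f {..<k} \<in> space (leb k)"
  by (simp add: space_PiM)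

lemma measure_leb_ball:
  assumes "0 < R"
  shows "measure (leb k) {x \<in> space (leb k). nsq k (\<lambda>i. x i - c i) \<le> R\<^sup>2} = R ^ k * unit_vol k"
proof -
  have "nsq k (\<lambda>i. (if i < k then c i + R * x i else undefined) - c i) = R\<^sup>2 * nsq k x" for x
    unfolding nsq_scale[symmetric] unfolding nsq_def by (intro sum.cong) auto
  then have "{x \<in> space (leb k). (\<lambda>i\<in>{..<k}. c i + R * x i) \<in>
      {x \<in> space (leb k). nsq k (\<lambda>i. x i - c i) \<le> R\<^sup>2}} = {x \<in> space (leb k). nsq k x \<le> 1}"
    using assms by (auto simp: mult_le_cancel_left1 power2_eq_square)
  then show ?thesis
    using assms measure_leb_affine[of R "{x \<in> space (leb k). nsq k (\<lambda>i. x i - c i) \<le> R\<^sup>2}" k c]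
    by (simp add: unit_vol_def)
qed

text \<open>The set lies in a box of finite volume. Finiteness has to be tracked because
  \<open>measure\<close> is 0 on sets of infinite measure and hence not monotone there.\<close>

lemma fmeasurable_leb_bounded:
  assumes "A \<in> sets (leb k)" and "\<And>x. x \<in> A \<Longrightarrow> nsq k x \<le> R"
  shows "A \<in> fmeasurable (leb k)"
proof -
  interpret product_sigma_finite "\<lambda>_::nat. lborel :: real measure"
    by unfold_locales
  define r where "r = sqrt \<bar>R\<bar>"
  define Q where "Q = Pi\<^sub>E {..<k} (\<lambda>_. {-r..r})"
  have Q: "Q \<in> sets (leb k)" unfolding Q_def by (intro sets_PiM_I_finite) auto
  have "emeasure (leb k) Q = (\<Prod>i<k. emeasure lborel {-r..r})"
    unfolding Q_def by (subst emeasure_PiM) auto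
  also have "\<dots> < \<infinity>"
    by (auto simp: r_def ennreal_power)
  finally have fin: "Q \<in> fmeasurable (leb k)" using Q by (simp add: fmeasurable_def)
  have "A \<subseteq> Q"
  proof
    fix x assume x: "x \<in> A"
    have sp: "x \<in> space (leb k)" using assms(1) x sets.sets_into_space by blast
    have "\<bar>x i\<bar> \<le> r" if "i < k" for i
    proof -
      have "(x i)\<^sup>2 \<le> nsq k x"
        unfolding nsq_def using that by (intro member_le_sum) auto
      also have "\<dots> \<le> \<bar>R\<bar>" using assms(2)[OF x] by simp
      finally show ?thesis unfolding r_def by (simp add: real_le_rsqrt)
    qed
    then show "x \<in> Q" using sp unfolding Q_def by (auto simp: space_PiM PiE_iff abs_le_iff minus_le_iff)
  qed
  then show ?thesis using fmeasurableI2[OF fin] assms(1) by blast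
qed

lemma fmeasurable_leb_ball:
  "{x \<in> space (leb k). nsq k x \<le> R} \<in> fmeasurable (leb k)"
  by (rule fmeasurable_leb_bounded[of _ _ R]) auto

text \<open>Double counting: integrate the sum of the indicators of the \<open>D i\<close>, which is
  at most \<open>n\<close> on \<open>W\<close> and vanishes elsewhere.\<close>

lemma sum_measure_le_multiplicity:
  assumes "finite I" and D: "\<And>i. i \<in> I \<Longrightarrow> D i \<in> sets M" "\<And>i. i \<in> I \<Longrightarrow> D i \<subseteq> W"
    and W: "W \<in> fmeasurable M"
    and mult: "\<And>y. y \<in> W \<Longrightarrow> real (card {i\<in>I. y \<in> D i}) \<le> n" and "0 \<le> n"
  shows "(\<Sum>i\<in>I. measure M (D i)) \<le> n * measure M W"
proof -
  have Df: "D i \<in> fmeasurable M" if "i \<in> I" for i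
    using fmeasurableI2[OF W] D that by blast
  have "(\<Sum>i\<in>I. measure M (D i)) = (\<Sum>i\<in>I. \<integral>y. indicator (D i) y \<partial>M)"
    by (intro sum.cong) (use Df in \<open>auto simp: fmeasurable_def sets.sets_into_space Int_absorb2\<close>)
  also have "\<dots> = (\<integral>y. (\<Sum>i\<in>I. indicator (D i) y) \<partial>M)"
    using Df by (intro Bochner_Integration.integral_sum[symmetric]) (auto simp: fmeasurable_def)
  also have "\<dots> \<le> (\<integral>y. n * indicator W y \<partial>M)"
  proof (rule integral_mono)
    show "integrable M (\<lambda>y. \<Sum>i\<in>I. indicator (D i) y :: real)"
      using Df by (intro Bochner_Integration.integrable_sum) (auto simp: fmeasurable_def)
    show "integrable M (\<lambda>y. n * indicator W y :: real)"
      using W by (auto simp: fmeasurable_def)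
    fix y
    have "(\<Sum>i\<in>I. indicator (D i) y :: real) = real (card {i\<in>I. y \<in> D i})"
      using \<open>finite I\<close> by (simp add: indicator_def sum.If_cases Int_def)
    also have "\<dots> \<le> n * indicator W y"
    proof (cases "y \<in> W")
      case True then show ?thesis using mult[of y] by simp
    next
      case False
      then have "{i\<in>I. y \<in> D i} = {}" using D(2) by blast
      then show ?thesis using False by (simp only: card.empty) simp
    qed
    finally show "(\<Sum>i\<in>I. indicator (D i) y :: real) \<le> n * indicator W y" .
  qed
  also have "\<dots> = n * measure M W"
    using W by (auto simp: fmeasurable_def sets.sets_into_space Int_absorb2)
  finally show ?thesis .
qed

section \<open>How many midpoints can be close to one point\<close>

lemma inp_affine: "inp k (\<lambda>i. x i + t * y i) z = inp k x z + t * inp k y z"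
  unfolding inp_def by (simp add: sum.distrib sum_distrib_left algebra_simps)

lemma inp_self: "inp k x x = nsq k x"
  unfolding inp_def nsq_def by (simp add: power2_eq_square)

lemma nsq_minus_commute: "nsq k (\<lambda>i. x i - y i) = nsq k (\<lambda>i. y i - x i)"
  unfolding nsq_def by (simp add: power2_commute)

lemma sum_sum_inp: "(\<Sum>i\<in>S. \<Sum>j\<in>S. inp k (v i) (v j)) = nsq k (\<lambda>t. \<Sum>i\<in>S. v i t)"
proof -
  have "(\<Sum>i\<in>S. \<Sum>j\<in>S. inp k (v i) (v j)) = (\<Sum>i\<in>S. \<Sum>t<k. \<Sum>j\<in>S. v i t * v j t)"
    unfolding inp_def by (intro sum.cong refl sum.swap)
  also have "\<dots> = (\<Sum>t<k. \<Sum>i\<in>S. \<Sum>j\<in>S. v i t * v j t)" by (rule sum.swap)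
  also have "\<dots> = nsq k (\<lambda>t. \<Sum>i\<in>S. v i t)"
    unfolding nsq_def by (simp add: power2_eq_square sum_product)
  finally show ?thesis .
qed

text \<open>Expand the square. The norm of the total vector carries the sign of \<open>s\<close>:
  dropping it gives an upper bound for s = -1 and a lower bound for s = 1.\<close>

lemma sum_sum_nsq:
  assumes "finite S"
  shows "(\<Sum>i\<in>S. \<Sum>j\<in>S. nsq k (\<lambda>t. v i t + s * v j t)) =
    (1 + s\<^sup>2) * real (card S) * (\<Sum>i\<in>S. nsq k (v i)) + 2 * s * nsq k (\<lambda>t. \<Sum>i\<in>S. v i t)"
  unfolding nsq_add sum_sum_inp[symmetric]
  by (simp add: sum.distrib sum_distrib_left algebra_simps)

text \<open>Let n be the size of \<open>S\<close> and U the sum of the |u_i|^2. Over all ordered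
  pairs, the |m_i - m_j|^2 sum to at most 2 n c U, as seen by expanding around \<open>y\<close>,
  while the |u_i + u_j|^2 sum to at least 2 n U. The separation compares the two sums except on the
  diagonal, which contributes 4 U. Hence (2n - 4) U <= 2 n c U.\<close>

lemma card_near_midpoints_le:
  assumes S: "finite S"
    and pos: "\<And>i. i \<in> S \<Longrightarrow> 0 < nsq k (u i)"
    and sep: "\<And>i j. \<lbrakk>i \<in> S; j \<in> S; i \<noteq> j\<rbrakk> \<Longrightarrow>
      nsq k (\<lambda>t. u i t + u j t) \<le> nsq k (\<lambda>t. m i t - m j t)"
    and near: "\<And>i. i \<in> S \<Longrightarrow> nsq k (\<lambda>t. y t - m i t) \<le> c * nsq k (u i)"
  shows "real (card S) * (1 - c) \<le> 2"
proof (cases "S = {}")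
  case False
  define n where "n = real (card S)"
  define U where "U = (\<Sum>i\<in>S. nsq k (u i))"
  have U: "0 < U" unfolding U_def using S False pos by (intro sum_pos) auto
  have "(\<Sum>i\<in>S. \<Sum>j\<in>S. nsq k (\<lambda>t. m i t - m j t)) =
      (\<Sum>i\<in>S. \<Sum>j\<in>S. nsq k (\<lambda>t. (y t - m i t) + (-1) * (y t - m j t)))"
  proof (intro sum.cong refl)
    fix i j
    have "(\<lambda>t. (y t - m i t) + (-1) * (y t - m j t)) = (\<lambda>t. m j t - m i t)" by auto
    then show "nsq k (\<lambda>t. m i t - m j t) = nsq k (\<lambda>t. (y t - m i t) + (-1) * (y t - m j t))"
      by (simp only: nsq_minus_commute[of k "m i" "m j"])
  qed
  also have "\<dots> \<le> 2 * n * (\<Sum>i\<in>S. nsq k (\<lambda>t. y t - m i t))"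
    using sum_sum_nsq[OF S, of k "\<lambda>i t. y t - m i t" "-1"] by (simp add: n_def)
  also have "\<dots> \<le> 2 * n * (\<Sum>i\<in>S. c * nsq k (u i))"
    by (intro mult_left_mono sum_mono near) (auto simp: n_def)
  finally have upper: "(\<Sum>i\<in>S. \<Sum>j\<in>S. nsq k (\<lambda>t. m i t - m j t)) \<le> 2 * n * c * U"
    by (simp add: U_def sum_distrib_left mult_ac)
  \<comment> \<open>The diagonal terms, where \<open>sep\<close> says nothing.\<close>
  have four: "nsq k (\<lambda>t. u i t + u i t) = 4 * nsq k (u i)" for i
    unfolding mult_2[symmetric] nsq_scale by simp
  have "2 * n * U \<le> (\<Sum>i\<in>S. \<Sum>j\<in>S. nsq k (\<lambda>t. u i t + u j t))"
    using sum_sum_nsq[OF S, of k u 1] by (simp add: n_def U_def)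
  also have "\<dots> \<le> (\<Sum>i\<in>S. \<Sum>j\<in>S. nsq k (\<lambda>t. m i t - m j t) + (if j = i then 4 * nsq k (u i) else 0))"
  proof (intro sum_mono)
    fix i j assume ij: "i \<in> S" "j \<in> S"
    show "nsq k (\<lambda>t. u i t + u j t) \<le> nsq k (\<lambda>t. m i t - m j t) + (if j = i then 4 * nsq k (u i) else 0)"
    proof (cases "j = i")
      case True
      then show ?thesis using four[of i] nsq_nonneg[of k "\<lambda>t. m i t - m j t"] by simp
    next
      case False
      then show ?thesis using sep[OF ij] by simp
    qed
  qed
  also have "\<dots> = (\<Sum>i\<in>S. \<Sum>j\<in>S. nsq k (\<lambda>t. m i t - m j t)) + 4 * U"
    using S by (simp add: sum.distrib U_def sum_distrib_left)
  finally have "(2 * n - 4) * U \<le> (2 * n * c) * U" using upper by (simp add: algebra_simps)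
  then have "2 * n - 4 \<le> 2 * n * c" using U by (simp only: mult_le_cancel_right_pos)
  then show ?thesis by (simp add: n_def algebra_simps)
qed simp

section \<open>Volumes of slices of balls\<close>

text \<open>The part of a ball around \<open>a\<close> between two hyperplanes orthogonal to
  \<open>m\<close>. The bounds \<open>l\<close> and \<open>h\<close> refer to inner products with
  the unnormalised \<open>m\<close>, so that m = 0 needs no separate treatment in the
  definition.\<close>

definition slab :: "nat \<Rightarrow> point \<Rightarrow> point \<Rightarrow> real \<Rightarrow> real \<Rightarrow> real \<Rightarrow> point set" where
  "slab k a m \<rho> l h = {x \<in> space (leb k). nsq k (\<lambda>i. x i - a i) \<le> \<rho>\<^sup>2 \<and>
     l \<le> inp k (\<lambda>i. x i - a i) m \<and> inp k (\<lambda>i. x i - a i) m \<le> h}"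

lemma slab_sets [measurable]: "slab k a m \<rho> l h \<in> sets (leb k)"
  unfolding slab_def by measurable

lemma slab_fmeasurable: "slab k (\<lambda>_. 0) m \<rho> l h \<in> fmeasurable (leb k)"
  by (rule fmeasurable_leb_bounded[of _ _ "\<rho>\<^sup>2"]) (auto simp: slab_def)

lemma nsq_cong: "(\<And>i. i < k \<Longrightarrow> f i = g i) \<Longrightarrow> nsq k f = nsq k g"
  unfolding nsq_def by (intro sum.cong) auto

lemma inp_cong: "(\<And>i. i < k \<Longrightarrow> f i = g i) \<Longrightarrow> inp k f m = inp k g m"
  unfolding inp_def by (intro sum.cong) auto

lemma measure_slab_translate: "measure (leb k) (slab k a m \<rho> l h) = measure (leb k) (slab k (\<lambda>_. 0) m \<rho> l h)"
proof -
  have "{x \<in> space (leb k). (\<lambda>i\<in>{..<k}. a i + 1 * x i) \<in> slab k a m \<rho> l h} = slab k (\<lambda>_. 0) m \<rho> l h"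
  proof -
    have "nsq k (\<lambda>i. (\<lambda>i\<in>{..<k}. a i + 1 * x i) i - a i) = nsq k x"
      "inp k (\<lambda>i. (\<lambda>i\<in>{..<k}. a i + 1 * x i) i - a i) m = inp k x m" for x
      by (auto intro: nsq_cong inp_cong)
    then show ?thesis by (simp add: slab_def)
  qed
  then show ?thesis using measure_leb_affine[of 1 "slab k a m \<rho> l h" k a] by simp
qed

text \<open>By Cauchy-Schwarz a large \<open>d\<close> makes the outer bounds void. The reflection
  at the origin then exchanges the two halves, which together cover the ball.\<close>

lemma measure_half_ball_ge:
  assumes "0 < \<rho>" and d: "\<And>x. nsq k x \<le> \<rho>\<^sup>2 \<Longrightarrow> \<bar>inp k x m\<bar> \<le> d"
  shows "\<rho> ^ k * unit_vol k / 2 \<le> measure (leb k) (slab k (\<lambda>_. 0) m \<rho> (-d) 0)"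
proof -
  let ?L = "slab k (\<lambda>_. 0) m \<rho> (-d) 0" and ?U = "slab k (\<lambda>_. 0) m \<rho> 0 d"
  have "nsq k (\<lambda>i\<in>{..<k}. 0 + (-1) * x i) = nsq k x"
    "inp k (\<lambda>i\<in>{..<k}. 0 + (-1) * x i) m = - inp k x m" for x
    using nsq_scale[of k "-1" x] inp_affine[of k "\<lambda>_. 0" "-1" x m]
    by (auto simp: inp_def)
  then have "{x \<in> space (leb k). (\<lambda>i\<in>{..<k}. 0 + (-1) * x i) \<in> ?U} = ?L"
    unfolding slab_def by (auto simp del: nsq_restrict inp_restrict)
  then have eq: "measure (leb k) ?U = measure (leb k) ?L"
    using measure_leb_affine[of "-1" ?U k "\<lambda>_. 0"] by simp
  have "{x \<in> space (leb k). nsq k x \<le> \<rho>\<^sup>2} = ?L \<union> ?U"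
    using d unfolding slab_def by (auto simp: abs_le_iff minus_le_iff)
  then have "\<rho> ^ k * unit_vol k = measure (leb k) (?L \<union> ?U)"
    using measure_leb_ball[OF assms(1), of k "\<lambda>_. 0"] by simp
  also have "\<dots> \<le> measure (leb k) ?L + measure (leb k) ?U"
    by (intro measure_Un_le) auto
  finally show ?thesis using eq by simp
qed

text \<open>
  A half ball is covered by \<open>J\<close> slices of thickness \<open>d\<close>. Moving a slice along \<open>m\<close> towards the
  equator keeps it in the ball, so the first slice is the largest.
\<close>

lemma measure_slab_ge:
  assumes "0 < \<rho>" "0 < d" "0 < J" and J: "nsq k m * \<rho>\<^sup>2 \<le> (real J * d)\<^sup>2"
  shows "\<rho> ^ k * unit_vol k / (2 * real J) \<le> measure (leb k) (slab k a m \<rho> (-d) 0)"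
proof -
  define S where "S j = slab k (\<lambda>_. 0) m \<rho> (- (real (Suc j) * d)) (- (real j * d))" for j
  have S [measurable]: "S j \<in> sets (leb k)" for j unfolding S_def by measurable
  have bd: "\<bar>inp k x m\<bar> \<le> real J * d" if "nsq k x \<le> \<rho>\<^sup>2" for x
  proof (rule power2_le_imp_le)
    have "(inp k x m)\<^sup>2 \<le> nsq k x * nsq k m" by (rule inp_cauchy)
    also have "\<dots> \<le> \<rho>\<^sup>2 * nsq k m" by (intro mult_right_mono that) simp
    finally show "\<bar>inp k x m\<bar>\<^sup>2 \<le> (real J * d)\<^sup>2" using J by (simp add: mult.commute)
  qed (use assms in simp)
  have shift: "measure (leb k) (S j) \<le> measure (leb k) (S 0)" for j
  proof (cases "nsq k m = 0")
    case True
    \<comment> \<open>There is no direction to move in when \<open>m\<close> vanishes, but then the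
      first slice is the whole ball.\<close>
    have "inp k x m = 0" for x using inp_cauchy[of k x m] True by simp
    then have "S j \<subseteq> S 0" using assms by (auto simp: S_def slab_def)
    then show ?thesis
      using slab_fmeasurable by (intro measure_mono_fmeasurable) (auto simp: S_def)
  next
    case False
    then have m: "0 < nsq k m" using nsq_nonneg[of k m] by linarith
    \<comment> \<open>Adding t m raises the inner product with \<open>m\<close> by exactly j d,
      which carries slice j to slice 0. On slice j the inner product is at most -j d, so the squared
      norm changes by t (2 inp + j d) <= 0 and the ball is not left.\<close>
    define t where "t = real j * d / nsq k m"
    have t: "0 \<le> t" "t * nsq k m = real j * d" using m assms by (auto simp: t_def)
    have "S j \<subseteq> {x \<in> space (leb k). (\<lambda>i\<in>{..<k}. t * m i + 1 * x i) \<in> S 0}"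
    proof
      fix x assume x: "x \<in> S j"
      then have xs: "x \<in> space (leb k)" "nsq k x \<le> \<rho>\<^sup>2"
        and l: "- (real (Suc j) * d) \<le> inp k x m" and h: "inp k x m \<le> - (real j * d)"
        by (auto simp: S_def slab_def)
      have i: "inp k (\<lambda>i. x i + t * m i) m = inp k x m + real j * d"
        using t by (simp add: inp_affine inp_self)
      have "nsq k (\<lambda>i. x i + t * m i) = nsq k x + t * (2 * inp k x m + t * nsq k m)"
        by (simp add: nsq_add algebra_simps power2_eq_square)
      also have "\<dots> \<le> nsq k x"
      proof -
        have "2 * inp k x m + t * nsq k m \<le> 0" using h t(2) assms(2)
          by (smt (verit) mult_nonneg_nonneg of_nat_0_le_iff)
        then have "t * (2 * inp k x m + t * nsq k m) \<le> 0" using t(1) by (rule mult_nonneg_nonpos[rotated])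
        then show ?thesis by simp
      qed
      finally have n: "nsq k (\<lambda>i. x i + t * m i) \<le> \<rho>\<^sup>2" using xs by simp
      have "(\<lambda>i. t * m i + 1 * x i) = (\<lambda>i. x i + t * m i)" by auto
      then show "x \<in> {x \<in> space (leb k). (\<lambda>i\<in>{..<k}. t * m i + 1 * x i) \<in> S 0}"
        using xs n i l h by (simp add: S_def slab_def algebra_simps)
    qed
    moreover have "{x \<in> space (leb k). (\<lambda>i\<in>{..<k}. t * m i + 1 * x i) \<in> S 0} \<in> fmeasurable (leb k)"
    proof -
      have "emeasure (leb k) (S 0) < \<infinity>"
        using slab_fmeasurable unfolding S_def by (auto simp: fmeasurable_def)
      then show ?thesis
        using emeasure_leb_affine[of 1 "S 0" k "\<lambda>i. t * m i"] by (intro fmeasurableI) auto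
    qed
    ultimately have "measure (leb k) (S j) \<le>
        measure (leb k) {x \<in> space (leb k). (\<lambda>i\<in>{..<k}. t * m i + 1 * x i) \<in> S 0}"
      using S by (intro measure_mono_fmeasurable) auto
    also have "\<dots> = measure (leb k) (S 0)"
      using measure_leb_affine[of 1 "S 0" k "\<lambda>i. t * m i"] by simp
    finally show ?thesis .
  qed
  have cover: "slab k (\<lambda>_. 0) m \<rho> (- (real J * d)) 0 \<subseteq> (\<Union>j<J. S j)"
  proof
    fix x assume x: "x \<in> slab k (\<lambda>_. 0) m \<rho> (- (real J * d)) 0"
    define s where "s = - inp k x m / d"
    have s: "0 \<le> s" "s \<le> real J" "inp k x m = - (s * d)"
      using x assms by (auto simp: slab_def s_def field_simps)
    \<comment> \<open>The minimum matters only at the far end s = J, which belongs to the last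
      slice.\<close>
    define j where "j = min (nat \<lfloor>s\<rfloor>) (J - 1)"
    have "j < J" using assms by (simp add: j_def)
    moreover have "real j \<le> s" using s(1) unfolding j_def by linarith
    moreover have "s \<le> real (Suc j)"
    proof (cases "nat \<lfloor>s\<rfloor> \<le> J - 1")
      case True then show ?thesis unfolding j_def by linarith
    next
      case False then show ?thesis using s assms unfolding j_def by linarith
    qed
    ultimately have "j < J" "real j * d \<le> s * d" "s * d \<le> real (Suc j) * d"
      using assms by (auto intro!: mult_right_mono)
    then have "x \<in> S j" using x s(3) by (simp add: S_def slab_def)
    then show "x \<in> (\<Union>j<J. S j)" using \<open>j < J\<close> by blast
  qed
  have "\<rho> ^ k * unit_vol k / 2 \<le> measure (leb k) (slab k (\<lambda>_. 0) m \<rho> (- (real J * d)) 0)"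
    by (rule measure_half_ball_ge[OF assms(1) bd])
  also have "\<dots> \<le> measure (leb k) (\<Union>j<J. S j)"
    using cover slab_fmeasurable by (intro measure_mono_fmeasurable fmeasurable.finite_UN) (auto simp: S_def)
  also have "\<dots> \<le> (\<Sum>j<J. measure (leb k) (S j))"
    using slab_fmeasurable by (intro measure_UNION_le) (auto simp: S_def)
  also have "\<dots> \<le> (\<Sum>j<J. measure (leb k) (S 0))" by (intro sum_mono shift)
  also have "\<dots> = real J * measure (leb k) (slab k a m \<rho> (-d) 0)"
    by (simp add: S_def measure_slab_translate[of k a])
  finally show ?thesis using assms by (simp add: field_simps)
qed

section \<open>Paths and matchings that no exchange of two edges improves\<close>

lemma euclid_dist_nsq: "euclid_dist k a b = sqrt (nsq k (\<lambda>i. a i - b i))"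
  by (simp add: euclid_dist_def L2_set_def nsq_def)

fun path_cost :: "('a \<Rightarrow> 'a \<Rightarrow> real) \<Rightarrow> 'a list \<Rightarrow> real" where
  "path_cost f (x # y # zs) = f x y + path_cost f (y # zs)"
| "path_cost f _ = 0"

lemma path_cost_append:
  "A \<noteq> [] \<Longrightarrow> B \<noteq> [] \<Longrightarrow> path_cost f (A @ B) = path_cost f A + f (last A) (hd B) + path_cost f B"
proof (induction A rule: induct_list012)
  case (2 x)
  then show ?case by (cases B) auto
qed auto

lemma path_cost_rev:
  assumes "\<And>x y. f x y = f y x"
  shows "path_cost f (rev A) = path_cost f A"
proof (induction A)
  case (Cons x A)
  show ?case
  proof (cases A)
    case (Cons y B)
    then have "path_cost f (rev A @ [x]) = path_cost f (rev A) + f (last (rev A)) x"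
      using path_cost_append[of "rev A" "[x]" f] by simp
    then show ?thesis using Cons Cons.IH assms[of y x] by (simp add: last_rev)
  qed simp
qed simp

text \<open>Cut the minimal path at the two edges into A, B, C and reverse the middle piece. By
  symmetry of \<open>f\<close> the cost inside B is unchanged, so only the two connecting edges
  differ.\<close>

lemma path_cost_two_opt:
  assumes sym: "\<And>x y. f x y = f y x"
    and min: "\<And>ys. distinct ys \<Longrightarrow> set ys = X \<Longrightarrow> path_cost f xs \<le> path_cost f ys"
    and xs: "distinct xs" "set xs = X" and ij: "i < j" "Suc j < length xs"
  shows "f (xs ! i) (xs ! Suc i) + f (xs ! j) (xs ! Suc j) \<le> f (xs ! i) (xs ! j) + f (xs ! Suc i) (xs ! Suc j)"
proof -
  define A where "A = take (Suc i) xs"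
  define B where "B = drop (Suc i) (take (Suc j) xs)"
  define C where "C = drop (Suc j) xs"
  have "A @ B = take (Suc j) xs"
    unfolding A_def B_def using ij by (metis append_take_drop_id min.absorb1 not_less_eq less_imp_le_nat take_take Suc_leI)
  then have eq: "xs = A @ B @ C" unfolding C_def by (metis append_assoc append_take_drop_id)
  have ne: "A \<noteq> []" "B \<noteq> []" "C \<noteq> []" using ij by (auto simp: A_def B_def C_def)
  have ends: "last A = xs ! i" "hd B = xs ! Suc i" "last B = xs ! j" "hd C = xs ! Suc j"
    using ij ne by (auto simp: A_def B_def C_def last_conv_nth hd_drop_conv_nth hd_conv_nth)
  have "path_cost f xs \<le> path_cost f (A @ rev B @ C)"
    using xs eq by (intro min) (auto simp del: append_assoc)
  moreover have "path_cost f (A @ rev B @ C) = path_cost f A + f (last A) (last B) + path_cost f B + f (hd B) (hd C) + path_cost f C"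
    using ne path_cost_rev[of f B, OF sym] by (simp add: path_cost_append hd_rev last_rev)
  moreover have "path_cost f xs = path_cost f A + f (last A) (hd B) + path_cost f B + f (last B) (hd C) + path_cost f C"
    unfolding eq using ne by (simp add: path_cost_append)
  ultimately show ?thesis using ends by simp
qed

lemma ex_path_two_opt:
  fixes f :: "'a \<Rightarrow> 'a \<Rightarrow> real"
  assumes sym: "\<And>x y. f x y = f y x" and fin: "finite X"
  shows "\<exists>xs. distinct xs \<and> set xs = X \<and>
    (\<forall>i j. i < j \<longrightarrow> Suc j < length xs \<longrightarrow>
      f (xs ! i) (xs ! Suc i) + f (xs ! j) (xs ! Suc j) \<le> f (xs ! i) (xs ! j) + f (xs ! Suc i) (xs ! Suc j))"
proof -
  let ?L = "{xs. distinct xs \<and> set xs = X}"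
  have "finite ?L" by (rule finite_subset[OF _ finite_subset_distinct[OF fin]]) auto
  moreover have "?L \<noteq> {}" using finite_distinct_list[OF fin] by auto
  ultimately obtain xs where xs: "xs \<in> ?L" "\<And>ys. ys \<in> ?L \<Longrightarrow> path_cost f xs \<le> path_cost f ys"
    using arg_min_if_finite[of ?L "path_cost f"] by (meson not_le)
  then show ?thesis using path_cost_two_opt[where f = f and X = X and xs = xs, OF sym] by (intro exI[of _ xs]) simp
qed

definition path_edges :: "'a list \<Rightarrow> 'a set set" where
  "path_edges xs = {{xs ! i, xs ! Suc i} | i. Suc i < length xs}"

lemma path_edges_adjacent:
  assumes "distinct xs" "{xs ! a, xs ! b} \<in> path_edges xs" "a < length xs" "b < length xs"
  shows "b = Suc a \<or> a = Suc b"
  using assms by (auto simp: path_edges_def doubleton_eq_iff nth_eq_iff_index_eq)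

text \<open>Take the vertex of the cycle that comes last in \<open>xs\<close>. Both its neighbours
  on the cycle must be its immediate predecessor in \<open>xs\<close>, but on a cycle of length at
  least 3 the neighbours are distinct.\<close>

lemma path_edges_acyclic:
  assumes xs: "distinct xs"
  shows "\<not> is_cycle (path_edges xs) vs"
proof
  assume cyc: "is_cycle (path_edges xs) vs"
  define n where "n = length vs"
  have n: "3 \<le> n" "distinct vs" and edge: "\<And>i. i < n \<Longrightarrow> {vs ! i, vs ! (Suc i mod n)} \<in> path_edges xs"
    using cyc by (auto simp: is_cycle_def n_def)
  have "\<exists>p < length xs. vs ! i = xs ! p" if i: "i < n" for i
  proof -
    obtain q where q: "{vs ! i, vs ! (Suc i mod n)} = {xs ! q, xs ! Suc q}" "Suc q < length xs"
      using edge[OF i] unfolding path_edges_def by blast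
    then have "vs ! i = xs ! q \<or> vs ! i = xs ! Suc q" by (auto simp: doubleton_eq_iff)
    then show ?thesis using q(2) Suc_lessD by blast
  qed
  then obtain p where p: "\<And>i. i < n \<Longrightarrow> p i < length xs" "\<And>i. i < n \<Longrightarrow> vs ! i = xs ! p i"
    by metis
  have adj: "p b = Suc (p a) \<or> p a = Suc (p b)" if "{vs ! a, vs ! b} \<in> path_edges xs" "a < n" "b < n" for a b
    using path_edges_adjacent[OF xs, of "p a" "p b"] that p by metis
  obtain a where a: "a < n" "\<And>b. b < n \<Longrightarrow> p b \<le> p a"
  proof -
    have "finite (p ` {..<n})" "p ` {..<n} \<noteq> {}" using n by (auto simp: lessThan_empty_iff)
    then have "Max (p ` {..<n}) \<in> p ` {..<n}" by (rule Max_in)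
    then obtain a where "a < n" "p a = Max (p ` {..<n})" by auto
    then show ?thesis using that[of a] by auto
  qed
  define b where "b = (if a = 0 then n - 1 else a - 1)"
  define c where "c = Suc a mod n"
  have b: "b < n" "Suc b mod n = a" using a(1) n by (auto simp: b_def)
  have c: "c < n" using n by (simp add: c_def)
  have "p a = Suc (p b)" using adj[of b a] edge[OF b(1)] b a by (metis not_less_eq_eq order_refl)
  moreover have "p a = Suc (p c)" using adj[of a c] edge[OF a(1)] c a by (metis c_def not_less_eq_eq order_refl)
  ultimately have "vs ! b = vs ! c" using p b c by simp
  then have "b = c" using n b c by (simp add: nth_eq_iff_index_eq n_def)
  then show False using n a(1) by (cases "Suc a = n") (auto simp: b_def c_def split: if_splits)
qed

lemma hamiltonian_path_edges: "distinct xs \<Longrightarrow> set xs = X \<Longrightarrow> hamiltonian_path X (path_edges xs)"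
  unfolding hamiltonian_path_def path_edges_def by blast

text \<open>This lets a single short Hamiltonian path bound both the path and the tree
  minimum.\<close>

lemma spanning_tree_path_edges:
  assumes "distinct xs" "set xs = X"
  shows "spanning_tree X (path_edges xs)"
proof -
  let ?R = "{(a, b). {a, b} \<in> path_edges xs}"
  have step: "(xs ! i, xs ! Suc i) \<in> ?R" if "Suc i < length xs" for i
    using that by (auto simp: path_edges_def)
  have fromto: "(xs ! i, xs ! j) \<in> ?R\<^sup>*" if "i \<le> j" "j < length xs" for i j
    using that
  proof (induction j rule: dec_induct)
    case (step j)
    then show ?case using \<open>\<And>i. Suc i < length xs \<Longrightarrow> _\<close> by (meson Suc_lessD rtrancl.rtrancl_into_rtrancl)
  qed auto
  have "sym ?R" by (auto simp: sym_def insert_commute)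
  then have "sym (?R\<^sup>*)" by (rule sym_rtrancl)
  then have any: "(xs ! i, xs ! j) \<in> ?R\<^sup>*" if "i < length xs" "j < length xs" for i j
    using fromto that by (meson linear symD)
  have "connected_graph X (path_edges xs)"
    unfolding connected_graph_def using any assms by (metis in_set_conv_nth)
  moreover have "path_edges xs \<subseteq> complete_edges X"
    using assms by (auto simp: path_edges_def complete_edges_def card_2_iff nth_eq_iff_index_eq)
      (metis lessI less_irrefl nth_eq_iff_index_eq Suc_lessD)+
  ultimately show ?thesis
    using path_edges_acyclic[OF assms(1)] by (auto simp: spanning_tree_def)
qed

text \<open>The edge set is an image of the index set, and merging equal edges can only decrease a
  sum of nonnegative terms.\<close>

lemma edge_sum_path_le:
  "edge_sum k (path_edges xs) \<le> (\<Sum>i | Suc i < length xs. euclid_dist k (xs ! i) (xs ! Suc i) ^ k)"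
proof -
  let ?I = "{i. Suc i < length xs}" and ?e = "\<lambda>i. {xs ! i, xs ! Suc i}"
  have fin: "finite ?I" by (rule finite_subset[of _ "{..<length xs}"]) auto
  have "path_edges xs = ?e ` ?I" by (auto simp: path_edges_def)
  then have "edge_sum k (path_edges xs) = (\<Sum>e\<in>?e ` ?I. edge_length k e ^ k)" by (simp add: edge_sum_def)
  also have "\<dots> \<le> (\<Sum>i\<in>?I. ((\<lambda>e. edge_length k e ^ k) \<circ> ?e) i)"
    by (rule sum_image_le[OF fin]) (simp add: euclid_dist_nsq)
  finally show ?thesis by simp
qed

lemma finite_hamiltonian_paths: "finite X \<Longrightarrow> finite {E. hamiltonian_path X E}"
  by (rule finite_subset[of _ "Pow (Pow X)"]) (auto simp: hamiltonian_path_def)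

lemma finite_spanning_trees: "finite X \<Longrightarrow> finite {E. spanning_tree X E}"
  by (rule finite_subset[of _ "Pow (Pow X)"]) (auto simp: spanning_tree_def complete_edges_def)

lemma finite_perfect_matchings: "finite X \<Longrightarrow> finite {E. perfect_matching X E}"
  by (rule finite_subset[of _ "Pow (Pow X)"]) (auto simp: perfect_matching_def complete_edges_def)

lemma HP_min_le: "finite X \<Longrightarrow> hamiltonian_path X E \<Longrightarrow> HP_min k X \<le> edge_sum k E"
  unfolding HP_min_def by (intro Min_le) (auto simp: finite_hamiltonian_paths)

lemma ST_min_le: "finite X \<Longrightarrow> spanning_tree X E \<Longrightarrow> ST_min k X \<le> edge_sum k E"
  unfolding ST_min_def by (intro Min_le) (auto simp: finite_spanning_trees)

lemma PM_min_le: "finite X \<Longrightarrow> perfect_matching X E \<Longrightarrow> PM_min k X \<le> edge_sum k E"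
  unfolding PM_min_def by (intro Min_le) (auto simp: finite_perfect_matchings)

lemma ex_perfect_matching: "finite X \<Longrightarrow> even (card X) \<Longrightarrow> \<exists>E. perfect_matching X E"
proof (induction "card X" arbitrary: X rule: less_induct)
  case less
  show ?case
  proof (cases "X = {}")
    case True
    then show ?thesis by (intro exI[of _ "{}"]) (auto simp: perfect_matching_def)
  next
    case False
    then have "card X \<noteq> 0" using less by simp
    then have "2 \<le> card X" using less(3) by (cases "card X = 1") auto
    then obtain Y where "Y \<subseteq> X" "card Y = 2" by (meson obtain_subset_with_card_n)
    then obtain a b where ab: "a \<in> X" "b \<in> X" "a \<noteq> b" by (auto simp: card_2_iff)
    let ?Y = "X - {a, b}"
    have "card ?Y = card X - 2" using ab less by (simp add: card_Diff_subset)
    then have "card ?Y < card X" "even (card ?Y)" using \<open>2 \<le> card X\<close> less(3) by auto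
    then obtain E where E: "perfect_matching ?Y E" using less(1)[of ?Y] less(2) by blast
    have sub: "e \<subseteq> ?Y" if "e \<in> E" for e using E that by (auto simp: perfect_matching_def complete_edges_def)
    have "perfect_matching X (insert {a, b} E)"
      unfolding perfect_matching_def
    proof (intro conjI ballI)
      show "insert {a, b} E \<subseteq> complete_edges X"
        using E ab by (auto simp: perfect_matching_def complete_edges_def)
      fix x assume x: "x \<in> X"
      show "\<exists>!e. e \<in> insert {a, b} E \<and> x \<in> e"
      proof (cases "x \<in> {a, b}")
        case True
        then show ?thesis using sub by (intro ex1I[of _ "{a, b}"]) auto
      next
        case False
        then have "\<exists>!e. e \<in> E \<and> x \<in> e" using E x by (auto simp: perfect_matching_def)
        then show ?thesis using False by auto
      qed
    qed
    then show ?thesis by blast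
  qed
qed

lemma perfect_matching_disjoint:
  assumes "perfect_matching X E" "e \<in> E" "f \<in> E" "x \<in> e" "x \<in> f"
  shows "e = f"
proof -
  have "x \<in> X" using assms by (auto simp: perfect_matching_def complete_edges_def)
  then have "\<exists>!e. e \<in> E \<and> x \<in> e" using assms(1) by (simp add: perfect_matching_def)
  then show ?thesis using assms by blast
qed

text \<open>The last three conclusions say that the two new edges are distinct and were not present
  before, so the change in total cost involves exactly four edges.\<close>

lemma perfect_matching_swap:
  assumes E: "perfect_matching X E" and e: "{a, b} \<in> E" "{c, d} \<in> E" "{a, b} \<noteq> {c, d}"
  shows "perfect_matching X (E - {{a, b}, {c, d}} \<union> {{a, c}, {b, d}})"
    "{a, c} \<notin> E" "{b, d} \<notin> E" "{a, c} \<noteq> {b, d}"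
proof -
  have in_X: "a \<in> X" "b \<in> X" "c \<in> X" "d \<in> X" and ne: "a \<noteq> b" "c \<noteq> d"
    using E e by (auto simp: perfect_matching_def complete_edges_def)
  have dist: "a \<noteq> c" "a \<noteq> d" "b \<noteq> c" "b \<noteq> d"
    using perfect_matching_disjoint[OF E e(1,2)] e(3) by auto
  show "{a, c} \<notin> E"
    using perfect_matching_disjoint[OF E e(1), of "{a, c}" a] dist ne by (auto simp: doubleton_eq_iff)
  show "{b, d} \<notin> E"
    using perfect_matching_disjoint[OF E e(1), of "{b, d}" b] dist ne by (auto simp: doubleton_eq_iff)
  show "{a, c} \<noteq> {b, d}" using dist ne by (auto simp: doubleton_eq_iff)
  let ?E = "E - {{a, b}, {c, d}} \<union> {{a, c}, {b, d}}"
  show "perfect_matching X ?E"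
    unfolding perfect_matching_def
  proof (intro conjI ballI)
    show "?E \<subseteq> complete_edges X"
      using E in_X dist by (auto simp: perfect_matching_def complete_edges_def)
    fix x assume x: "x \<in> X"
    obtain g where g: "g \<in> E" "x \<in> g" using E x by (auto simp: perfect_matching_def)
    have uniq: "h = g" if "h \<in> E" "x \<in> h" for h using perfect_matching_disjoint[OF E that(1) g(1) that(2) g(2)] .
    show "\<exists>!e. e \<in> ?E \<and> x \<in> e"
    proof (cases "x \<in> {a, b, c, d}")
      case True
      have "h = {a, b} \<or> h = {c, d}" if "h \<in> E" "x \<in> h" for h
        using perfect_matching_disjoint[OF E that(1) e(1) that(2)] perfect_matching_disjoint[OF E that(1) e(2) that(2)] True by blast
      then have only: "h = {a, c} \<or> h = {b, d}" if "h \<in> ?E" "x \<in> h" for h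
        using that by blast
      show ?thesis
      proof (cases "x \<in> {a, c}")
        case True
        then have "x \<notin> {b, d}" using dist ne by auto
        moreover have "{a, c} \<in> ?E" by blast
        ultimately show ?thesis using True only by metis
      next
        case False
        then have "x \<in> {b, d}" using \<open>x \<in> {a, b, c, d}\<close> by auto
        moreover have "{b, d} \<in> ?E" by blast
        ultimately show ?thesis using False only by metis
      qed
    next
      case False
      show ?thesis
      proof (rule ex1I[of _ g])
        show "g \<in> ?E \<and> x \<in> g" using g False by blast
        show "h = g" if "h \<in> ?E \<and> x \<in> h" for h using uniq[of h] that False by blast
      qed
    qed
  qed
qed

text \<open>A matching of minimal total cost cannot be improved by a swap. Since {c, d} = {d, c},
  the conclusion covers both ways of reconnecting two edges.\<close>

lemma ex_perfect_matching_two_opt: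
  fixes f :: "'a \<Rightarrow> 'a \<Rightarrow> real"
  assumes sym: "\<And>x y. f x y = f y x" and fin: "finite X" and even: "even (card X)"
  shows "\<exists>E. perfect_matching X E \<and>
    (\<forall>a b c d. {a, b} \<in> E \<longrightarrow> {c, d} \<in> E \<longrightarrow> {a, b} \<noteq> {c, d} \<longrightarrow> f a b + f c d \<le> f a c + f b d)"
proof -
  \<comment> \<open>The cost as a function of unordered pairs, well defined by the symmetry of
    \<open>f\<close>.\<close>
  define F where "F e = (THE r. \<exists>a b. e = {a, b} \<and> r = f a b)" for e
  have F: "F {a, b} = f a b" for a b
    unfolding F_def by (rule the_equality) (auto simp: doubleton_eq_iff sym)
  let ?M = "{E. perfect_matching X E}"
  have "finite ?M" "?M \<noteq> {}" using finite_perfect_matchings[OF fin] ex_perfect_matching[OF fin even] by auto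
  then obtain E where E: "perfect_matching X E" "\<And>E'. perfect_matching X E' \<Longrightarrow> sum F E \<le> sum F E'"
    using arg_min_if_finite[of ?M "sum F"] by (metis (no_types) mem_Collect_eq not_le)
  have finE: "finite E" using E(1) fin
    by (intro finite_subset[of E "Pow X"]) (auto simp: perfect_matching_def complete_edges_def)
  have "f a b + f c d \<le> f a c + f b d" if e: "{a, b} \<in> E" "{c, d} \<in> E" "{a, b} \<noteq> {c, d}" for a b c d
  proof -
    note sw = perfect_matching_swap[OF E(1) e]
    let ?D = "E - {{a, b}, {c, d}}"
    have "sum F E = sum F ?D + sum F {{a, b}, {c, d}}"
      using finE e by (intro sum.subset_diff) auto
    moreover have "sum F (?D \<union> {{a, c}, {b, d}}) = sum F ?D + sum F {{a, c}, {b, d}}"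
      using finE sw by (intro sum.union_disjoint) auto
    ultimately show ?thesis using E(2)[OF sw(1)] e(3) sw(4) by (simp add: F)
  qed
  then show ?thesis using E(1) by blast
qed

section \<open>The volume near the cube compared with that of its circumscribed ball\<close>

text \<open>The distance of \<open>t\<close> from [-1/2, 1/2], one side of the centred cube.\<close>

definition cube_gap :: "real \<Rightarrow> real" where
  "cube_gap t = max 0 (\<bar>t\<bar> - 1/2)"

lemma measurable_cube_gap [measurable]: "cube_gap \<in> borel_measurable borel"
  unfolding cube_gap_def by measurable

text \<open>The interval contributes 1 and each of the two exponential tails 1/9.\<close>

lemma nn_integral_exp_cube_gap:
  "(\<integral>\<^sup>+t. ennreal (exp (- 9 * cube_gap t)) \<partial>lborel) \<le> ennreal (11/9)"
proof -
  define T where "T = (\<lambda>t::real. ennreal (exp (- 9 * (t - 1/2))) * indicator {1/2..} t)"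
  have T [measurable]: "T \<in> borel_measurable borel" unfolding T_def by measurable
  have "((\<lambda>t::real. - exp (- 9 * (t - 1/2)) / 9) \<longlongrightarrow> 0) at_top"
    by real_asymp
  then have I: "(\<integral>\<^sup>+t. T t \<partial>lborel) = ennreal (0 - - exp (- 9 * (1/2 - 1/2)) / 9)"
    unfolding T_def by (intro nn_integral_FTC_atLeast) (auto intro!: derivative_eq_intros)
  then have I1: "(\<integral>\<^sup>+t. T t \<partial>lborel) = ennreal (1/9)" by simp
  have I2: "(\<integral>\<^sup>+t. T (-t) \<partial>lborel) = ennreal (1/9)"
    using nn_integral_real_affine[OF T, of "-1" 0] I1 by simp
  have "(\<integral>\<^sup>+t. ennreal (exp (- 9 * cube_gap t)) \<partial>lborel) \<le>
      (\<integral>\<^sup>+t. indicator {-1/2..1/2} t + (T t + T (-t)) \<partial>lborel)"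
  proof (rule nn_integral_mono)
    fix t :: real
    consider "t < -1/2" | "\<bar>t\<bar> \<le> 1/2" | "1/2 < t" by linarith
    then show "ennreal (exp (- 9 * cube_gap t)) \<le> indicator {-1/2..1/2} t + (T t + T (-t))"
    proof cases
      case 1
      then have "- 9 * cube_gap t = - 9 * (- t - 1/2)" by (simp add: cube_gap_def)
      then show ?thesis using 1 by (simp add: T_def)
    next
      case 2
      then have "cube_gap t = 0" "t \<in> {-1/2..1/2}" by (auto simp: cube_gap_def)
      then show ?thesis by (simp add: add_increasing2)
    next
      case 3
      then have "- 9 * cube_gap t = - 9 * (t - 1/2)" by (simp add: cube_gap_def)
      then show ?thesis using 3 by (simp add: T_def)
    qed
  qed
  also have "\<dots> = ennreal 1 + (ennreal (1/9) + ennreal (1/9))"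
    by (subst nn_integral_add, measurable)+ (simp add: I1 I2)
  also have "\<dots> = ennreal (1 + (1/9 + 1/9))"
    by (subst ennreal_plus, simp, simp)+
  also have "\<dots> = ennreal (11/9)" by simp
  finally show ?thesis .
qed

text \<open>A neighbourhood in the l1 distance rather than the Euclidean one: the exponential of a
  sum over coordinates is a product, so its integral factors.\<close>

definition near_cube :: "nat \<Rightarrow> point set" where
  "near_cube k = {y \<in> space (leb k). (\<Sum>i<k. cube_gap (y i)) \<le> real k / 40}"

lemma near_cube_sets [measurable]: "near_cube k \<in> sets (leb k)"
  unfolding near_cube_def by measurable

text \<open>Exponential tilting; the factor 9 makes the base smaller than that in \<open>ball_volume_ge\<close>.\<close>

lemma emeasure_near_cube: "emeasure (leb k) (near_cube k) \<le> ennreal (1.56 ^ k)"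
proof -
  interpret product_sigma_finite "\<lambda>_::nat. lborel :: real measure"
    by unfold_locales
  let ?g = "\<lambda>t. ennreal (exp (9/40) * exp (- 9 * cube_gap t))"
  have "emeasure (leb k) (near_cube k) = (\<integral>\<^sup>+y. indicator (near_cube k) y \<partial>leb k)" by simp
  also have "\<dots> \<le> (\<integral>\<^sup>+y. (\<Prod>i<k. ?g (y i)) \<partial>leb k)"
  proof (intro nn_integral_mono)
    fix y
    show "indicator (near_cube k) y \<le> (\<Prod>i<k. ?g (y i))"
    proof (cases "y \<in> near_cube k")
      case True
      \<comment> \<open>On the set the total gap is at most k/40, so the exponent is nonnegative;
        9/40 is the share of one coordinate.\<close>
      have "1 \<le> exp (real k * (9/40) - 9 * (\<Sum>i<k. cube_gap (y i)))"
        using True by (simp add: near_cube_def)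
      also have "\<dots> = exp (\<Sum>i<k. 9/40 + - 9 * cube_gap (y i))"
        by (simp add: sum_subtractf sum_distrib_left)
      also have "\<dots> = (\<Prod>i<k. exp (9/40) * exp (- 9 * cube_gap (y i)))"
        by (simp only: exp_sum[OF finite_lessThan] exp_add)
      finally have "ennreal 1 \<le> ennreal (\<Prod>i<k. exp (9/40) * exp (- 9 * cube_gap (y i)))"
        by (intro ennreal_leI)
      then show ?thesis using True by (simp add: prod_ennreal)
    qed simp
  qed
  also have "\<dots> = (\<Prod>i<k. \<integral>\<^sup>+t. ?g t \<partial>lborel)"
    by (intro product_nn_integral_prod) auto
  also have "\<dots> = (\<integral>\<^sup>+t. ?g t \<partial>lborel) ^ k" by simp
  also have "(\<integral>\<^sup>+t. ?g t \<partial>lborel) = ennreal (exp (9/40)) * (\<integral>\<^sup>+t. ennreal (exp (- 9 * cube_gap t)) \<partial>lborel)"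
    by (subst nn_integral_cmult[symmetric]) (auto simp: ennreal_mult)
  also have "\<dots> ^ k \<le> (ennreal (exp (9/40)) * ennreal (11/9)) ^ k"
    by (intro power_mono mult_left_mono nn_integral_exp_cube_gap) auto
  also have "\<dots> = ennreal ((exp (9/40) * (11/9)) ^ k)"
    by (simp add: ennreal_power ennreal_mult[symmetric] del: ennreal_mult'')
  also have "\<dots> \<le> ennreal (1.56 ^ k)"
  proof (intro ennreal_leI power_mono)
    have "exp (9/40::real) \<le> 1 + 9/40 + (9/40)\<^sup>2" by (rule exp_bound) auto
    then show "exp (9/40) * (11/9) \<le> (1.56::real)" by (simp add: power2_eq_square)
  qed auto
  finally show ?thesis .
qed

lemma near_cube_fmeasurable: "near_cube k \<in> fmeasurable (leb k)"
  using emeasure_near_cube[of k] by (intro fmeasurableI) (auto simp: le_less_trans)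

lemma measure_near_cube: "measure (leb k) (near_cube k) \<le> 1.56 ^ k"
  using emeasure_near_cube[of k] unfolding measure_def by (metis enn2real_leI zero_le_numeral zero_le_power zero_le_divide_iff)

text \<open>Cauchy-Schwarz turns the Euclidean bound sqrt k / 40 into the l1 bound k / 40, and a gap
  is at most the distance to any point of the interval.\<close>

lemma near_cube_if_close:
  assumes y: "y \<in> space (leb k)" and m: "\<And>i. i < k \<Longrightarrow> \<bar>m i\<bar> \<le> 1/2"
    and near: "nsq k (\<lambda>i. y i - m i) \<le> real k / 1600"
  shows "y \<in> near_cube k"
proof -
  have "(\<Sum>i<k. \<bar>y i - m i\<bar>)\<^sup>2 \<le> (\<Sum>i<k. \<bar>y i - m i\<bar>\<^sup>2) * real (card {..<k})"
    by (rule sum_squared_le_sum_of_squares)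
  also have "\<dots> \<le> (real k / 1600) * real k"
    using mult_right_mono[OF near, of "real k"] by (simp add: nsq_def)
  also have "\<dots> = (real k / 40)\<^sup>2" by (simp add: power2_eq_square)
  finally have "(\<Sum>i<k. \<bar>y i - m i\<bar>) \<le> real k / 40" by (rule power2_le_imp_le) simp
  moreover have "(\<Sum>i<k. cube_gap (y i)) \<le> (\<Sum>i<k. \<bar>y i - m i\<bar>)"
  proof (rule sum_mono)
    fix i assume "i \<in> {..<k}"
    then have "\<bar>m i\<bar> \<le> 1/2" using m by simp
    then show "cube_gap (y i) \<le> \<bar>y i - m i\<bar>" unfolding cube_gap_def by linarith
  qed
  ultimately show ?thesis using y by (simp add: near_cube_def)
qed

text \<open>
  Markov's inequality on the box $[-4/5,4/5]^k$: the second moment of a coordinate is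
  $16/75 < 1/4$, so a fixed proportion of the box lies in the ball.
\<close>

lemma ball_volume_ge:
  assumes k: "1 \<le> k"
  shows "14/100 * 1.6 ^ k \<le> (sqrt (real k) / 2) ^ k * unit_vol k"
proof -
  interpret product_sigma_finite "\<lambda>_::nat. lborel :: real measure"
    by unfold_locales
  define A :: "real set" where "A = {-4/5..4/5}"
  define B where "B = Pi\<^sub>E {..<k} (\<lambda>_. A)"
  define W where "W = {x \<in> space (leb k). nsq k x \<le> (sqrt (real k) / 2)\<^sup>2}"
  have [measurable]: "A \<in> sets borel" by (simp add: A_def)
  have B [measurable]: "B \<in> sets (leb k)" unfolding B_def by (intro sets_PiM_I_finite) auto
  have W [measurable]: "W \<in> sets (leb k)" unfolding W_def by measurable
  have mW: "measure (leb k) W = (sqrt (real k) / 2) ^ k * unit_vol k"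
    unfolding W_def using measure_leb_ball[of "sqrt (real k) / 2" k "\<lambda>_. 0"] k by simp
  have eB: "emeasure (leb k) B = ennreal (1.6 ^ k)"
    unfolding B_def A_def by (subst emeasure_PiM) (auto simp: ennreal_power)
  have indB: "indicator B x = (\<Prod>j<k. indicator A (x j) :: ennreal)" if "x \<in> space (leb k)" for x
    using that by (auto simp: B_def space_PiM PiE_iff indicator_def prod_zero_iff)
  have sq: "(\<integral>\<^sup>+t. ennreal (t\<^sup>2) * indicator A t \<partial>lborel) = ennreal (128/375)" 
  proof -
    have "(\<integral>\<^sup>+t. ennreal (t\<^sup>2) * indicator {-4/5..4/5} t \<partial>lborel) = ennreal ((4/5)^3/3 - (-4/5)^3/3)"
      by (rule nn_integral_FTC_Icc) (auto intro!: derivative_eq_intros)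
    then show ?thesis by (simp add: A_def power3_eq_cube)
  qed
  have one: "(\<integral>\<^sup>+x. ennreal ((x i)\<^sup>2) * indicator B x \<partial>leb k) = ennreal (128/375 * 1.6 ^ (k - 1))" if i: "i < k" for i
  proof -
    let ?g = "\<lambda>j t. (if j = i then ennreal (t\<^sup>2) else 1) * indicator A t"
    have "(\<integral>\<^sup>+x. ennreal ((x i)\<^sup>2) * indicator B x \<partial>leb k) = (\<integral>\<^sup>+x. (\<Prod>j<k. ?g j (x j)) \<partial>leb k)"
      using i by (intro nn_integral_cong) (simp add: indB prod.distrib prod.delta)
    also have "\<dots> = (\<Prod>j<k. \<integral>\<^sup>+t. ?g j t \<partial>lborel)"
      by (intro product_nn_integral_prod) auto
    also have "\<dots> = (\<integral>\<^sup>+t. ?g i t \<partial>lborel) * (\<Prod>j\<in>{..<k} - {i}. \<integral>\<^sup>+t. ?g j t \<partial>lborel)"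
      using i by (intro prod.remove) auto
    also have "(\<Prod>j\<in>{..<k} - {i}. \<integral>\<^sup>+t. ?g j t \<partial>lborel) = (\<Prod>j\<in>{..<k} - {i}. ennreal 1.6)"
      by (intro prod.cong) (auto simp: A_def)
    also have "\<dots> = ennreal (1.6 ^ (k - 1))" using i by (simp add: ennreal_power)
    also have "(\<integral>\<^sup>+t. ?g i t \<partial>lborel) = ennreal (128/375)" using sq by simp
    also have "ennreal (128/375) * ennreal (1.6 ^ (k - 1)) = ennreal (128/375 * 1.6 ^ (k - 1))"
      by (rule ennreal_mult[symmetric]) auto
    finally show ?thesis .
  qed
  have "(\<integral>\<^sup>+x. ennreal (nsq k x) * indicator B x \<partial>leb k) =
      (\<integral>\<^sup>+x. (\<Sum>i<k. ennreal ((x i)\<^sup>2) * indicator B x) \<partial>leb k)"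
    unfolding nsq_def by (intro nn_integral_cong) (subst sum_ennreal[symmetric], simp, rule sum_distrib_right)
  also have "\<dots> = (\<Sum>i<k. ennreal (128/375 * 1.6 ^ (k - 1)))"
    by (subst nn_integral_sum) (auto simp: one)
  also have "\<dots> = ennreal (real k * (128/375 * 1.6 ^ (k - 1)))"
    by (subst sum_ennreal) auto
  \<comment> \<open>128/375 is the integral of t^2 over an interval of length 1.6, so the mean is
    16/75.\<close>
  also have "real k * (128/375 * 1.6 ^ (k - 1)) = real k * (16/75) * 1.6 ^ k"
    using k by (cases k) auto
  finally have second: "(\<integral>\<^sup>+x. ennreal (nsq k x) * indicator B x \<partial>leb k) = ennreal (real k * (16/75) * 1.6 ^ k)" .
  \<comment> \<open>Outside the ball the squared norm exceeds k/4. Markov loses the proportion 4 *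
    16/75 = 64/75 of the box, and the remaining 11/75 exceeds 14/100.\<close>
  have "emeasure (leb k) (B - W) = (\<integral>\<^sup>+x. indicator (B - W) x \<partial>leb k)" by simp
  also have "\<dots> \<le> (\<integral>\<^sup>+x. ennreal (4 / real k) * (ennreal (nsq k x) * indicator B x) \<partial>leb k)"
  proof (rule nn_integral_mono)
    fix x assume x: "x \<in> space (leb k)"
    show "indicator (B - W) x \<le> ennreal (4 / real k) * (ennreal (nsq k x) * indicator B x)"
    proof (cases "x \<in> B - W")
      case True
      then have "1 \<le> 4 / real k * nsq k x"
        using k x by (auto simp: W_def power_divide field_simps)
      then have "ennreal 1 \<le> ennreal (4 / real k * nsq k x)" by (rule ennreal_leI)
      also have "\<dots> = ennreal (4 / real k) * ennreal (nsq k x)" by (rule ennreal_mult) auto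
      finally show ?thesis using True by simp
    qed simp
  qed
  also have "\<dots> = ennreal (4 / real k) * ennreal (real k * (16/75) * 1.6 ^ k)"
    by (subst nn_integral_cmult) (auto simp: second)
  also have "\<dots> = ennreal (64/75 * 1.6 ^ k)"
    using k by (subst ennreal_mult[symmetric]) auto
  finally have bad: "emeasure (leb k) (B - W) \<le> ennreal (64/75 * 1.6 ^ k)" .
  have WF: "W \<in> fmeasurable (leb k)" unfolding W_def by (rule fmeasurable_leb_ball)
  have "ennreal (1.6 ^ k) \<le> emeasure (leb k) (W \<union> (B - W))"
    unfolding eB[symmetric] by (intro emeasure_mono) auto
  also have "\<dots> \<le> emeasure (leb k) W + emeasure (leb k) (B - W)"
    by (intro emeasure_subadditive) auto
  also have "\<dots> \<le> ennreal (measure (leb k) W) + ennreal (64/75 * 1.6 ^ k)"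
    using bad WF by (intro add_mono) (auto simp: fmeasurable_def emeasure_eq_ennreal_measure)
  also have "\<dots> = ennreal (measure (leb k) W + 64/75 * 1.6 ^ k)"
    by (subst ennreal_plus) auto
  finally have "1.6 ^ k \<le> measure (leb k) W + 64/75 * 1.6 ^ k"
    by (subst (asm) ennreal_le_iff) auto
  moreover have "(0::real) \<le> 1.6 ^ k" by simp
  ultimately show ?thesis unfolding mW by linarith
qed

section \<open>Packing regions around the midpoints\<close>

text \<open>Compares distances from two centres on the line through 0 and \<open>m\<close>. With b =
  0 it locates a region in a ball around the origin, with b = 1 it measures the distance to the
  midpoint.\<close>

lemma nsq_shift:
  "nsq k (\<lambda>i. y i - b * m i) = nsq k (\<lambda>i. y i - a * m i) + 2 * (a - b) * inp k (\<lambda>i. y i - a * m i) m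
     + (a - b)\<^sup>2 * nsq k m"
proof -
  have "(\<lambda>i. y i - b * m i) = (\<lambda>i. (y i - a * m i) + (a - b) * m i)" by (auto simp: algebra_simps)
  then show ?thesis using nsq_add[of k "\<lambda>i. y i - a * m i" "a - b" m] by simp
qed

text \<open>
  Midpoints \<open>m i\<close>, relative to the centre of the cube, and half edge vectors \<open>u i\<close>.
\<close>

locale midpoint_family =
  fixes k :: nat and I :: "'i set" and m u :: "'i \<Rightarrow> point"
  assumes k: "1 \<le> k" and fin: "finite I"
    and pos: "i \<in> I \<Longrightarrow> 0 < nsq k (u i)"
    and in_ball: "i \<in> I \<Longrightarrow> nsq k (m i) + nsq k (u i) \<le> real k / 4"
    and sep: "\<lbrakk>i \<in> I; j \<in> I; i \<noteq> j\<rbrakk> \<Longrightarrow> nsq k (\<lambda>t. u i t + u j t) \<le> nsq k (\<lambda>t. m i t - m j t)"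
begin

abbreviation r :: "'i \<Rightarrow> real" where
  "r i \<equiv> sqrt (nsq k (u i))"

text \<open>The multiplicity bound \<open>n\<close> is required for natural numbers \<open>l\<close>
  only, so that integrality can sharpen 2 / (1 - c).\<close>

lemma packing:
  assumes J: "J \<subseteq> I" and W: "W \<in> fmeasurable (leb k)"
    and D: "\<And>i. i \<in> J \<Longrightarrow> D i \<in> sets (leb k)" "\<And>i. i \<in> J \<Longrightarrow> D i \<subseteq> W"
    and near: "\<And>i y. \<lbrakk>i \<in> J; y \<in> D i\<rbrakk> \<Longrightarrow> nsq k (\<lambda>t. y t - m i t) \<le> c * nsq k (u i)"
    and n: "\<And>l::nat. real l * (1 - c) \<le> 2 \<Longrightarrow> real l \<le> n"
  shows "(\<Sum>i\<in>J. measure (leb k) (D i)) \<le> n * measure (leb k) W"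
proof (rule sum_measure_le_multiplicity)
  show "finite J" using J fin by (rule finite_subset)
  show "real (card {i \<in> J. y \<in> D i}) \<le> n" for y
  proof (rule n, rule card_near_midpoints_le[of _ k u m y c])
    show "finite {i \<in> J. y \<in> D i}" using \<open>finite J\<close> by simp
    show "nsq k (\<lambda>t. u i t + u j t) \<le> nsq k (\<lambda>t. m i t - m j t)"
      if "i \<in> {i \<in> J. y \<in> D i}" "j \<in> {i \<in> J. y \<in> D i}" "i \<noteq> j" for i j
      using that sep J by blast
  qed (use J pos near in auto)
  show "0 \<le> n" using n[of 0] by simp
qed (use D W in auto)

lemma unit_vol_pos: "0 < unit_vol k"
proof -
  have "0 < (14/100 * 1.6 ^ k :: real)" by simp
  then have "0 < (sqrt (real k) / 2) ^ k * unit_vol k" using ball_volume_ge[OF k] by linarith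
  moreover have "0 < (sqrt (real k) / 2) ^ k" using k by simp
  ultimately show ?thesis by (simp only: zero_less_mult_pos)
qed

text \<open>Half balls of radius \<open>\<alpha> * r i\<close> around the midpoints, facing the
  origin, stay in the ball of radius sqrt k / 2. The three factors of the bound are 2 for halving, k
  + 1 for the multiplicity, and e for undoing the shrinking, as (1 + 1/k)^k <= e.\<close>

lemma sum_power_le: "(\<Sum>i\<in>I. (2 * r i) ^ k) \<le> 2 * exp 1 * (real k + 1) * sqrt (real k) ^ k"
proof -
  define \<alpha> where "\<alpha> = real k / (real k + 1)"
  have \<alpha>: "0 < \<alpha>" "\<alpha> \<le> 1" using k by (auto simp: \<alpha>_def)
  define W where "W = {y \<in> space (leb k). nsq k y \<le> (sqrt (real k) / 2)\<^sup>2}"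
  have mW: "measure (leb k) W = (sqrt (real k) / 2) ^ k * unit_vol k"
    unfolding W_def using measure_leb_ball[of "sqrt (real k) / 2" k "\<lambda>_. 0"] k by simp
  \<comment> \<open>Chosen so large that the lower bound of the slab is void: x <= (1 + x)^2 lets
    \<open>measure_slab_ge\<close> apply with a single slice.\<close>
  define d where "d i = 1 + nsq k (m i) * (\<alpha> * r i)\<^sup>2" for i
  define D where "D i = slab k (m i) (m i) (\<alpha> * r i) (- d i) 0" for i
  have sq: "(\<alpha> * r i)\<^sup>2 = \<alpha>\<^sup>2 * nsq k (u i)" for i by (simp add: power_mult_distrib)
  have "(\<Sum>i\<in>I. measure (leb k) (D i)) \<le> (real k + 1) * measure (leb k) W"
  proof (rule packing)
    show "W \<in> fmeasurable (leb k)" unfolding W_def by (rule fmeasurable_leb_ball)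
    show "D i \<in> sets (leb k)" for i unfolding D_def by measurable
    show "D i \<subseteq> W" if i: "i \<in> I" for i
    proof
      fix y assume y: "y \<in> D i"
      \<comment> \<open>The mixed term is at most 0 on the side facing the origin.\<close>
      have "nsq k y \<le> nsq k (\<lambda>t. y t - m i t) + nsq k (m i)"
        using nsq_shift[of k y 0 "m i" 1] y by (simp add: D_def slab_def)
      also have "\<dots> \<le> \<alpha>\<^sup>2 * nsq k (u i) + nsq k (m i)"
        using y by (simp add: D_def slab_def sq)
      also have "\<dots> \<le> nsq k (u i) + nsq k (m i)"
        using \<alpha> by (simp add: mult_left_le_one_le power_le_one)
      also have "\<dots> \<le> (sqrt (real k) / 2)\<^sup>2" using in_ball[OF i] by (simp add: power_divide)
      finally show "y \<in> W" using y by (simp add: W_def D_def slab_def)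
    qed
    show "nsq k (\<lambda>t. y t - m i t) \<le> \<alpha>\<^sup>2 * nsq k (u i)" if "y \<in> D i" for i y
      using that by (simp add: D_def slab_def sq)
    show "real l \<le> real k + 1" if l: "real l * (1 - \<alpha>\<^sup>2) \<le> 2" for l :: nat
    proof (rule ccontr)
      assume "\<not> real l \<le> real k + 1"
      then have "real (k + 1) < real l" by simp
      then have "k + 2 \<le> l" by (simp only: of_nat_less_iff)
      then have "real (k + 2) \<le> real l" by (simp only: of_nat_le_iff)
      then have "real k + 2 \<le> real l" by simp
      moreover have "1 - \<alpha>\<^sup>2 = (2 * real k + 1) / (real k + 1)\<^sup>2"
      proof -
        have "(real k + 1)\<^sup>2 \<noteq> 0" by (simp add: add_nonneg_eq_0_iff)
        then have "1 - \<alpha>\<^sup>2 = ((real k + 1)\<^sup>2 - (real k)\<^sup>2) / (real k + 1)\<^sup>2"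
          by (simp only: \<alpha>_def power_divide diff_divide_distrib) simp
        then show ?thesis by (simp add: power2_eq_square algebra_simps)
      qed
      \<comment> \<open>Multiplicity k + 2 would force 2k^2 + 5k + 2 <= 2k^2 + 4k + 2.\<close>
      ultimately have "(real k + 2) * ((2 * real k + 1) / (real k + 1)\<^sup>2) \<le> 2"
        using l by (smt (verit, best) divide_nonneg_nonneg mult_right_mono of_nat_0_le_iff zero_le_power2)
      then have "(real k + 2) * (2 * real k + 1) \<le> 2 * (real k + 1)\<^sup>2"
        by (simp add: divide_le_eq)
      then show False using k by (simp add: power2_eq_square algebra_simps)
    qed
  qed simp
  moreover have "(\<alpha> * r i) ^ k * unit_vol k / 2 \<le> measure (leb k) (D i)" if i: "i \<in> I" for i
  proof -
    have "nsq k (m i) * (\<alpha> * r i)\<^sup>2 \<le> (real 1 * d i)\<^sup>2"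
    proof -
      have "0 \<le> nsq k (m i) * (\<alpha> * r i)\<^sup>2" by simp
      moreover have "x \<le> (1 + x)\<^sup>2" if "0 \<le> x" for x :: real using that by (simp add: power2_eq_square algebra_simps)
      ultimately show ?thesis by (simp add: d_def)
    qed
    moreover have "0 < d i" unfolding d_def by (simp add: add_pos_nonneg)
    ultimately show ?thesis
      using measure_slab_ge[of "\<alpha> * r i" "d i" 1 k "m i" "m i"] \<alpha> pos[OF i] by (simp add: D_def)
  qed
  ultimately have "(\<Sum>i\<in>I. (\<alpha> * r i) ^ k * unit_vol k / 2) \<le> (real k + 1) * ((sqrt (real k) / 2) ^ k * unit_vol k)"
    unfolding mW by (meson order_trans sum_mono)
  then have "(\<Sum>i\<in>I. (\<alpha> * r i) ^ k) * (unit_vol k / 2) \<le> (real k + 1) * ((sqrt (real k) / 2) ^ k * unit_vol k)"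
    by (simp only: times_divide_eq_right[symmetric] sum_distrib_right[symmetric])
  also have "\<dots> = (2 * (real k + 1) * (sqrt (real k) / 2) ^ k) * (unit_vol k / 2)"
    by simp
  finally have *: "(\<Sum>i\<in>I. (\<alpha> * r i) ^ k) \<le> 2 * (real k + 1) * (sqrt (real k) / 2) ^ k"
    using unit_vol_pos by (subst (asm) mult_le_cancel_right_pos) auto
  have "(\<Sum>i\<in>I. (2 * r i) ^ k) = (2 / \<alpha>) ^ k * (\<Sum>i\<in>I. (\<alpha> * r i) ^ k)"
    using \<alpha> by (simp add: sum_distrib_left power_mult_distrib power_divide)
  also have "\<dots> \<le> (2 / \<alpha>) ^ k * (2 * (real k + 1) * (sqrt (real k) / 2) ^ k)"
    using * \<alpha> by (intro mult_left_mono) auto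
  also have "\<dots> = (1 / \<alpha>) ^ k * (2 * (real k + 1) * sqrt (real k) ^ k)"
    by (simp add: power_divide)
  also have "\<dots> \<le> exp 1 * (2 * (real k + 1) * sqrt (real k) ^ k)"
  proof (rule mult_right_mono)
    have "(1 / \<alpha>) ^ k = (1 + 1 / real k) ^ k" using k by (simp add: \<alpha>_def add_divide_distrib)
    also have "\<dots> \<le> exp (1 / real k) ^ k" by (intro power_mono exp_ge_add_one_self) simp
    also have "\<dots> = exp 1" using k by (simp add: exp_of_nat_mult[symmetric])
    finally show "(1 / \<alpha>) ^ k \<le> exp 1" .
  qed simp
  finally show ?thesis by (simp add: mult_ac)
qed

text \<open>Moving the centres to (1 - \<open>\<beta>\<close>) m_i makes the regions fit into a ball
  of squared radius 2399/2400 Q, where Q = k/4. This beats the shrinking factor 3199/3200, so the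
  bound decays exponentially relative to k^(k/2). Only a thin slice next to the equator is used,
  because deeper points are too far from m_i for the multiplicity bound.\<close>

lemma sum_power_medium_le:
  assumes J: "J \<subseteq> I" and lo: "\<And>i. i \<in> J \<Longrightarrow> real k / 4 \<le> 400 * nsq k (u i)"
    and hi: "\<And>i. i \<in> J \<Longrightarrow> nsq k (u i) \<le> 2 / 3 * (real k / 4)"
  shows "(\<Sum>i\<in>J. (2 * r i) ^ k) \<le> 12800 * 25600 * sqrt ((2399/2400) / (3199/3200)) ^ k * sqrt (real k) ^ k"
proof -
  define Q where "Q = real k / 4"
  define \<beta> :: real where "\<beta> = 1/1600"
  define \<gamma> where "\<gamma> = sqrt (3199/3200 :: real)"
  define R where "R = sqrt (2399/2400) * (sqrt (real k) / 2)"
  have Q: "0 < Q" using k by (simp add: Q_def)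
  have \<gamma>: "0 < \<gamma>" "\<gamma>\<^sup>2 = 3199/3200" by (auto simp: \<gamma>_def)
  have R: "0 < R" "R\<^sup>2 = 2399/2400 * Q" using k by (auto simp: R_def Q_def power_mult_distrib power_divide)
  define W where "W = {y \<in> space (leb k). nsq k y \<le> R\<^sup>2}"
  have mW: "measure (leb k) W = R ^ k * unit_vol k"
    unfolding W_def using measure_leb_ball[OF R(1), of k "\<lambda>_. 0"] by simp
  define D where "D i = slab k (\<lambda>t. (1 - \<beta>) * m i t) (m i) (\<gamma> * r i) (- (Q / 6400)) 0" for i
  have sq: "(\<gamma> * r i)\<^sup>2 = 3199/3200 * nsq k (u i)" for i by (simp add: power_mult_distrib \<gamma>)
  have "(\<Sum>i\<in>J. measure (leb k) (D i)) \<le> 25600 * measure (leb k) W"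
  proof (rule packing[OF J])
    show "W \<in> fmeasurable (leb k)" unfolding W_def by (rule fmeasurable_leb_ball)
    show "D i \<in> sets (leb k)" for i unfolding D_def by measurable
    show "D i \<subseteq> W" if i: "i \<in> J" for i
    proof
      fix y assume y: "y \<in> D i"
      have "nsq k y \<le> nsq k (\<lambda>t. y t - (1 - \<beta>) * m i t) + (1 - \<beta>)\<^sup>2 * nsq k (m i)"
        using nsq_shift[of k y 0 "m i" "1 - \<beta>"] y
        by (simp add: D_def slab_def \<beta>_def)
      also have "\<dots> \<le> 3199/3200 * nsq k (u i) + (1 - \<beta>)\<^sup>2 * nsq k (m i)"
        using y by (simp add: D_def slab_def sq)
      \<comment> \<open>The coefficient of |u_i|^2 is positive here, so the worst case is |u_i|^2 =
        2Q/3.\<close>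
      also have "\<dots> \<le> 3199/3200 * nsq k (u i) + (1 - \<beta>)\<^sup>2 * (Q - nsq k (u i))"
        using in_ball[of i] i J by (intro add_left_mono mult_left_mono) (auto simp: Q_def)
      also have "\<dots> \<le> 2399/2400 * Q"
      proof -
        have "(1 - \<beta>)\<^sup>2 = 2556801/2560000" by (simp add: \<beta>_def power2_eq_square)
        moreover have "nsq k (u i) \<le> 2 / 3 * Q" using hi[OF i] by (simp add: Q_def)
        ultimately show ?thesis using Q by (simp only: right_diff_distrib)
      qed
      finally show "y \<in> W" using y by (simp add: W_def R D_def slab_def)
    qed
    show "nsq k (\<lambda>t. y t - m i t) \<le> (1 - 1/12800) * nsq k (u i)" if i: "i \<in> J" and y: "y \<in> D i" for i y
    proof -
      \<comment> \<open>Shrinking saves 4/12800 of |u_i|^2. The two terms caused by the shift cost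
        at most 3/12800 of it, since Q <= 400 |u_i|^2. The rest, 1/12800, gives multiplicity
        25600.\<close>
      have "nsq k (\<lambda>t. y t - m i t) \<le> 3199/3200 * nsq k (u i) + 2 * \<beta> * (Q / 6400) + \<beta>\<^sup>2 * nsq k (m i)"
        using nsq_shift[of k y 1 "m i" "1 - \<beta>"] y
        by (simp add: D_def slab_def sq \<beta>_def)
      also have "\<dots> \<le> 3199/3200 * nsq k (u i) + 2 * \<beta> * (Q / 6400) + \<beta>\<^sup>2 * Q"
        using in_ball[of i] i J nsq_nonneg[of k "u i"] by (intro add_left_mono mult_left_mono) (auto simp: Q_def simp del: nsq_nonneg)
      also have "\<dots> \<le> (1 - 1/12800) * nsq k (u i)"
        using lo[OF i] by (simp add: Q_def \<beta>_def power2_eq_square)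
      finally show ?thesis .
    qed
  qed simp
  moreover have "(\<gamma> * r i) ^ k * unit_vol k / 12800 \<le> measure (leb k) (D i)" if i: "i \<in> J" for i
  proof -
    have u: "0 < nsq k (u i)" "nsq k (m i) + nsq k (u i) \<le> Q"
      using pos[of i] in_ball[of i] i J by (auto simp: Q_def)
    \<comment> \<open>Inner products with m_i are at most Q in absolute value, so 6400 slices cover
      the half ball and the first has at least 1/12800 of the ball.\<close>
    have "nsq k (m i) * (\<gamma> * r i)\<^sup>2 \<le> Q * Q"
      unfolding sq using u nsq_nonneg[of k "m i"] Q by (intro mult_mono) linarith+
    then have "nsq k (m i) * (\<gamma> * r i)\<^sup>2 \<le> (real 6400 * (Q / 6400))\<^sup>2"
      by (simp add: power2_eq_square)
    then show ?thesis
      using measure_slab_ge[of "\<gamma> * r i" "Q / 6400" 6400 k "m i" "\<lambda>t. (1 - \<beta>) * m i t"] \<gamma> u Q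
      by (simp add: D_def)
  qed
  ultimately have "(\<Sum>i\<in>J. (\<gamma> * r i) ^ k * unit_vol k / 12800) \<le> 25600 * (R ^ k * unit_vol k)"
    unfolding mW by (meson order_trans sum_mono)
  then have "(\<Sum>i\<in>J. (\<gamma> * r i) ^ k) * (unit_vol k / 12800) \<le> 25600 * (R ^ k * unit_vol k)"
    by (simp only: times_divide_eq_right[symmetric] sum_distrib_right[symmetric])
  also have "\<dots> = (12800 * 25600 * R ^ k) * (unit_vol k / 12800)"
    by simp
  finally have *: "(\<Sum>i\<in>J. (\<gamma> * r i) ^ k) \<le> 12800 * 25600 * R ^ k"
    using unit_vol_pos by (subst (asm) mult_le_cancel_right_pos) auto
  have "(\<Sum>i\<in>J. (2 * r i) ^ k) = (2 / \<gamma>) ^ k * (\<Sum>i\<in>J. (\<gamma> * r i) ^ k)"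
    using \<gamma> by (simp add: sum_distrib_left power_mult_distrib power_divide)
  also have "\<dots> \<le> (2 / \<gamma>) ^ k * (12800 * 25600 * R ^ k)"
    using * \<gamma> by (intro mult_left_mono) auto
  also have "\<dots> = 12800 * 25600 * sqrt ((2399/2400) / (3199/3200)) ^ k * sqrt (real k) ^ k"
    unfolding R_def \<gamma>_def real_sqrt_divide by (simp add: power_divide power_mult_distrib mult_ac)
  finally show ?thesis .
qed

text \<open>Full balls with squared radius 49/50 |u_i|^2 have multiplicity at most 2 / (1/50) = 100
  and stay in \<open>near_cube\<close>. Its volume is at most 1.56^k, against at least 0.14 * 1.6^k
  for the ball around the cube.\<close>

lemma sum_power_small_le:
  assumes J: "J \<subseteq> I" and cube: "\<And>i t. \<lbrakk>i \<in> J; t < k\<rbrakk> \<Longrightarrow> \<bar>m i t\<bar> \<le> 1/2"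
    and hi: "\<And>i. i \<in> J \<Longrightarrow> 400 * nsq k (u i) \<le> real k / 4"
  shows "(\<Sum>i\<in>J. (2 * r i) ^ k) \<le> 100 / (14/100) * (1.56 / (1.6 * sqrt (49/50))) ^ k * sqrt (real k) ^ k"
proof -
  define \<gamma> where "\<gamma> = sqrt (49/50 :: real)"
  have \<gamma>: "0 < \<gamma>" "\<gamma>\<^sup>2 = 49/50" by (auto simp: \<gamma>_def)
  define D where "D i = {y \<in> space (leb k). nsq k (\<lambda>t. y t - m i t) \<le> (\<gamma> * r i)\<^sup>2}" for i
  have sq: "(\<gamma> * r i)\<^sup>2 = 49/50 * nsq k (u i)" for i by (simp add: power_mult_distrib \<gamma>)
  have "(\<Sum>i\<in>J. measure (leb k) (D i)) \<le> 100 * measure (leb k) (near_cube k)"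
  proof (rule packing[OF J near_cube_fmeasurable])
    show "D i \<in> sets (leb k)" for i unfolding D_def by measurable
    show "D i \<subseteq> near_cube k" if i: "i \<in> J" for i
    proof
      fix y assume y: "y \<in> D i"
      \<comment> \<open>The factor 400 in \<open>hi\<close> is what
        \<open>near_cube_if_close\<close> demands: 4 * 400 = 1600.\<close>
      have "nsq k (\<lambda>t. y t - m i t) \<le> real k / 1600"
        using y hi[OF i] nsq_nonneg[of k "u i"] unfolding D_def sq by (simp del: nsq_nonneg)
      then show "y \<in> near_cube k"
        using near_cube_if_close[of y k "m i"] y cube[OF i] by (simp add: D_def)
    qed
    show "nsq k (\<lambda>t. y t - m i t) \<le> 49/50 * nsq k (u i)" if "y \<in> D i" for i y
      using that by (simp add: D_def sq)
  qed simp
  moreover have "measure (leb k) (D i) = (\<gamma> * r i) ^ k * unit_vol k" if i: "i \<in> J" for i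
    unfolding D_def using pos[of i] i J \<gamma> by (intro measure_leb_ball) auto
  ultimately have 1: "(\<Sum>i\<in>J. (\<gamma> * r i) ^ k) * unit_vol k \<le> 100 * 1.56 ^ k"
    using measure_near_cube[of k] by (simp add: sum_distrib_right)
  define S where "S = (\<Sum>i\<in>J. (\<gamma> * r i) ^ k)"
  have S: "0 \<le> S" using \<gamma> by (auto simp: S_def intro!: sum_nonneg)
  have "S * (14/100 * 1.6 ^ k) \<le> S * ((sqrt (real k) / 2) ^ k * unit_vol k)"
    by (intro mult_left_mono ball_volume_ge k S)
  also have "\<dots> = (S * unit_vol k) * (sqrt (real k) / 2) ^ k" by simp
  also have "\<dots> \<le> (100 * 1.56 ^ k) * (sqrt (real k) / 2) ^ k"
    using 1 by (intro mult_right_mono) (auto simp: S_def)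
  finally have *: "S \<le> (100 * 1.56 ^ k) * (sqrt (real k) / 2) ^ k / (14/100 * 1.6 ^ k)"
    by (simp add: pos_le_divide_eq del: power_divide)
  have "(\<Sum>i\<in>J. (2 * r i) ^ k) = (2 / \<gamma>) ^ k * S"
    using \<gamma> by (simp add: S_def sum_distrib_left power_mult_distrib power_divide)
  also have "\<dots> \<le> (2 / \<gamma>) ^ k * ((100 * 1.56 ^ k) * (sqrt (real k) / 2) ^ k / (14/100 * 1.6 ^ k))"
    using * \<gamma> by (intro mult_left_mono) auto
  also have "\<dots> = 100 / (14/100) * (1.56 / (1.6 * sqrt (49/50))) ^ k * sqrt (real k) ^ k"
  proof -
    have "(2 / g) ^ k * ((100 * a ^ k) * (s / 2) ^ k / (14/100 * b ^ k)) = 100 / (14/100) * (a / (b * g)) ^ k * s ^ k"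
      if "g \<noteq> 0" "b \<noteq> 0" for a b g s :: real
      using that by (simp add: power_divide power_mult_distrib mult_ac)
    then show ?thesis unfolding \<gamma>_def by (rule) auto
  qed
  finally show ?thesis .
qed

end

text \<open>Interchanging the endpoints of one edge turns u_j into -u_j. A matching is also optimal
  against this second exchange, which yields \<open>sep'\<close>.\<close>

locale matching_family = midpoint_family +
  assumes sep': "\<lbrakk>i \<in> I; j \<in> I; i \<noteq> j\<rbrakk> \<Longrightarrow> nsq k (\<lambda>t. u i t - u j t) \<le> nsq k (\<lambda>t. m i t - m j t)"
    and cube: "\<lbrakk>i \<in> I; t < k\<rbrakk> \<Longrightarrow> \<bar>m i t\<bar> \<le> 1/2"
begin

text \<open>By the parallelogram law the two separations average to |u_i|^2 + |u_j|^2 <= |m_i -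
  m_j|^2 <= 2 |m_i|^2 + 2 |m_j|^2 <= k - 2 |u_i|^2 - 2 |u_j|^2. Hence |u_i|^2 + |u_j|^2 <= k/3,
  which is where the threshold k/6 comes from.\<close>

lemma long_unique:
  assumes ij: "i \<in> I" "j \<in> I" and long: "real k / 6 < nsq k (u i)" "real k / 6 < nsq k (u j)"
  shows "i = j"
proof (rule ccontr)
  assume ne: "i \<noteq> j"
  have pm: "nsq k (\<lambda>t. v t + w t) + nsq k (\<lambda>t. v t - w t) = 2 * nsq k v + 2 * nsq k w" for v w
    using nsq_add[of k v 1 w] nsq_add[of k v "-1" w] by simp
  have "nsq k (u i) + nsq k (u j) \<le> nsq k (\<lambda>t. m i t - m j t)"
    using sep[OF ij ne] sep'[OF ij ne] pm[of "u i" "u j"] by linarith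
  also have "\<dots> \<le> 2 * nsq k (m i) + 2 * nsq k (m j)"
    using pm[of "m i" "m j"] nsq_nonneg[of k "\<lambda>t. m i t + m j t"] by linarith
  finally show False using long in_ball[OF ij(1)] in_ball[OF ij(2)] by linarith
qed

text \<open>The edges are split into long, medium and short ones. The single long edge gives the
  leading term, since 2 |u_i| <= sqrt k.\<close>

lemma sum_power_le_asymp:
  "(\<Sum>i\<in>I. (2 * r i) ^ k) \<le> (1 + 12800 * 25600 * sqrt ((2399/2400) / (3199/3200)) ^ k
     + 100 / (14/100) * (1.56 / (1.6 * sqrt (49/50))) ^ k) * sqrt (real k) ^ k"
proof -
  define L where "L = {i \<in> I. real k / 6 < nsq k (u i)}"
  define S where "S = {i \<in> I. 400 * nsq k (u i) < real k / 4}"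
  define M where "M = {i \<in> I. real k / 4 \<le> 400 * nsq k (u i) \<and> nsq k (u i) \<le> real k / 6}"
  have I: "I = L \<union> (M \<union> S)" and disj: "L \<inter> (M \<union> S) = {}" "M \<inter> S = {}"
    by (auto simp: L_def M_def S_def)
  have fins: "finite L" "finite M" "finite S" using fin by (auto simp: L_def M_def S_def)
  have "(\<Sum>i\<in>L. (2 * r i) ^ k) \<le> sqrt (real k) ^ k"
  proof (cases "L = {}")
    case False
    then obtain i where i: "i \<in> L" by blast
    then have "L = {i}" using long_unique by (auto simp: L_def)
    moreover have "2 * r i \<le> sqrt (real k)"
    proof -
      have "nsq k (u i) \<le> real k / 4"
        using in_ball[of i] i nsq_nonneg[of k "m i"] by (simp add: L_def del: nsq_nonneg)
      then have "sqrt (4 * nsq k (u i)) \<le> sqrt (real k)" by simp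
      then show ?thesis by (simp add: real_sqrt_mult)
    qed
    ultimately show ?thesis using power_mono[of "2 * r i" "sqrt (real k)" k] by simp
  qed simp
  moreover have "(\<Sum>i\<in>M. (2 * r i) ^ k) \<le> 12800 * 25600 * sqrt ((2399/2400) / (3199/3200)) ^ k * sqrt (real k) ^ k"
    by (rule sum_power_medium_le) (auto simp: M_def)
  moreover have "(\<Sum>i\<in>S. (2 * r i) ^ k) \<le> 100 / (14/100) * (1.56 / (1.6 * sqrt (49/50))) ^ k * sqrt (real k) ^ k"
  proof (rule sum_power_small_le)
    show "\<bar>m i t\<bar> \<le> 1/2" if "i \<in> S" "t < k" for i t
      using cube[of i t] that by (simp add: S_def)
  qed (auto simp: S_def)
  moreover have "(\<Sum>i\<in>I. (2 * r i) ^ k) = (\<Sum>i\<in>L. (2 * r i) ^ k) + ((\<Sum>i\<in>M. (2 * r i) ^ k) + (\<Sum>i\<in>S. (2 * r i) ^ k))"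
    unfolding I using disj fins by (subst sum.union_disjoint, simp, simp, simp)+ simp
  ultimately show ?thesis by (simp only: distrib_right mult_1_left)
qed

end

section \<open>From optimal edge sets to families of midpoints\<close>

text \<open>Subtracting 1/2 moves the centre of the unit cube to the origin.\<close>

definition mid :: "point \<Rightarrow> point \<Rightarrow> point" where
  "mid a b = (\<lambda>t. (a t + b t) / 2 - 1/2)"

definition half :: "point \<Rightarrow> point \<Rightarrow> point" where
  "half a b = (\<lambda>t. (a t - b t) / 2)"

lemma mid_commute: "mid a b = mid b a"
  by (simp add: mid_def add.commute)

lemma nsq_diff_half: "nsq k (\<lambda>t. a t - b t) = 4 * nsq k (half a b)"
  unfolding nsq_def half_def by (simp add: sum_distrib_left power_divide)

lemma euclid_dist_half: "euclid_dist k a b = 2 * sqrt (nsq k (half a b))"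
  unfolding euclid_dist_nsq nsq_diff_half by (simp add: real_sqrt_mult)

text \<open>Twice the difference of the two sides of the conclusion equals the gain |a - c|^2 + |b -
  d|^2 - |a - b|^2 - |c - d|^2. This identity is the reason for optimising squares of
  lengths.\<close>

lemma two_opt_midpoints:
  assumes "nsq k (\<lambda>t. a t - b t) + nsq k (\<lambda>t. c t - d t) \<le> nsq k (\<lambda>t. a t - c t) + nsq k (\<lambda>t. b t - d t)"
  shows "nsq k (\<lambda>t. half a b t + half c d t) \<le> nsq k (\<lambda>t. mid a b t - mid c d t)"
proof -
  have "2 * nsq k (\<lambda>t. mid a b t - mid c d t) + nsq k (\<lambda>t. a t - b t) + nsq k (\<lambda>t. c t - d t) =
      2 * nsq k (\<lambda>t. half a b t + half c d t) + nsq k (\<lambda>t. a t - c t) + nsq k (\<lambda>t. b t - d t)"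
    unfolding nsq_def sum_distrib_left sum.distrib[symmetric]
    by (intro sum.cong refl) (simp add: mid_def half_def power2_eq_square field_simps)
  then show ?thesis using assms by linarith
qed

text \<open>By the parallelogram law the left side is the mean of the squared distances of
  \<open>a\<close> and \<open>b\<close> from the centre of the cube.\<close>

lemma mid_half_in_ball:
  assumes "a \<in> unit_cube k" "b \<in> unit_cube k"
  shows "nsq k (mid a b) + nsq k (half a b) \<le> real k / 4"
proof -
  have "(x - 1/2)\<^sup>2 \<le> 1/4" if "0 \<le> x" "x \<le> 1" for x :: real
  proof -
    have "0 \<le> x * (1 - x)" using that by simp
    then show ?thesis by (simp add: power2_eq_square algebra_simps)
  qed
  then have c: "(a t - 1/2)\<^sup>2 \<le> 1/4" "(b t - 1/2)\<^sup>2 \<le> 1/4" if "t < k" for t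
    using assms that by (auto simp: unit_cube_def PiE_iff)
  have "nsq k (mid a b) + nsq k (half a b) = (\<Sum>t<k. ((a t - 1/2)\<^sup>2 + (b t - 1/2)\<^sup>2) / 2)"
    unfolding nsq_def sum.distrib[symmetric]
    by (intro sum.cong refl) (simp add: mid_def half_def power2_eq_square field_simps)
  also have "\<dots> \<le> (\<Sum>t<k. 1/4)"
  proof (rule sum_mono)
    fix t assume "t \<in> {..<k}"
    then show "((a t - 1/2)\<^sup>2 + (b t - 1/2)\<^sup>2) / 2 \<le> 1/4" using c[of t] by simp
  qed
  finally show ?thesis by simp
qed

lemma abs_mid_le:
  assumes "a \<in> unit_cube k" "b \<in> unit_cube k" "t < k"
  shows "\<bar>mid a b t\<bar> \<le> 1/2"
proof -
  have "0 \<le> a t" "a t \<le> 1" "0 \<le> b t" "b t \<le> 1"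
    using assms by (auto simp: unit_cube_def PiE_iff)
  then show ?thesis by (simp add: mid_def abs_le_iff field_simps)
qed

lemma nsq_half_pos:
  assumes "a \<in> unit_cube k" "b \<in> unit_cube k" "a \<noteq> b"
  shows "0 < nsq k (half a b)"
proof -
  have "\<exists>t<k. a t \<noteq> b t"
    using assms unfolding unit_cube_def by (metis PiE_ext lessThan_iff)
  then obtain t where t: "t < k" "half a b t \<noteq> 0" by (auto simp: half_def)
  have "0 < (half a b t)\<^sup>2" using t by simp
  also have "\<dots> \<le> nsq k (half a b)"
    unfolding nsq_def using t by (intro member_le_sum) auto
  finally show ?thesis .
qed

text \<open>The path is optimal for squared lengths, yet the packing bounds its sum of k-th
  powers.\<close>

lemma ex_short_path:
  assumes k: "1 \<le> k" and X: "finite X" "X \<subseteq> unit_cube k"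
  shows "\<exists>xs. distinct xs \<and> set xs = X \<and>
    edge_sum k (path_edges xs) \<le> 2 * exp 1 * (real k + 1) * sqrt (real k) ^ k"
proof -
  define f where "f a b = nsq k (\<lambda>t. a t - b t)" for a b :: point
  have sym: "f a b = f b a" for a b unfolding f_def by (rule nsq_minus_commute)
  obtain xs where xs: "distinct xs" "set xs = X" and opt: "\<And>i j. \<lbrakk>i < j; Suc j < length xs\<rbrakk> \<Longrightarrow>
      f (xs ! i) (xs ! Suc i) + f (xs ! j) (xs ! Suc j) \<le> f (xs ! i) (xs ! j) + f (xs ! Suc i) (xs ! Suc j)"
    using ex_path_two_opt[where f = f and X = X, OF sym X(1)] by blast
  define I where "I = {i. Suc i < length xs}"
  define m where "m i = mid (xs ! i) (xs ! Suc i)" for i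
  define u where "u i = half (xs ! i) (xs ! Suc i)" for i
  have cube: "xs ! i \<in> unit_cube k" "xs ! Suc i \<in> unit_cube k" if "i \<in> I" for i
    using that xs X unfolding I_def by (metis Suc_lessD mem_Collect_eq nth_mem subsetD)+
  have sep: "nsq k (\<lambda>t. u i t + u j t) \<le> nsq k (\<lambda>t. m i t - m j t)" if "i < j" "j \<in> I" for i j
    using two_opt_midpoints opt[of i j] that unfolding f_def m_def u_def I_def by blast
  interpret midpoint_family k I m u
  proof
    show "1 \<le> k" by (rule k)
    show "finite I" unfolding I_def by (rule finite_subset[of _ "{..<length xs}"]) auto
    show "0 < nsq k (u i)" if "i \<in> I" for i
      unfolding u_def using that cube xs by (intro nsq_half_pos) (auto simp: I_def nth_eq_iff_index_eq)
    show "nsq k (m i) + nsq k (u i) \<le> real k / 4" if "i \<in> I" for i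
      unfolding m_def u_def using that cube by (intro mid_half_in_ball) auto
    show "nsq k (\<lambda>t. u i t + u j t) \<le> nsq k (\<lambda>t. m i t - m j t)" if "i \<in> I" "j \<in> I" "i \<noteq> j" for i j
    proof (cases "i < j")
      case True
      then show ?thesis using sep that by blast
    next
      case False
      then have "nsq k (\<lambda>t. u j t + u i t) \<le> nsq k (\<lambda>t. m j t - m i t)" using sep[of j i] that by simp
      then show ?thesis by (simp only: nsq_minus_commute[of k "m i" "m j"] add.commute[of "u i _"])
    qed
  qed
  have "edge_sum k (path_edges xs) \<le> (\<Sum>i\<in>I. (2 * r i) ^ k)"
    using edge_sum_path_le[of k xs] by (simp only: I_def u_def euclid_dist_half)
  also note sum_power_le
  finally show ?thesis using xs by blast
qed

text \<open>The o(1) term: the contributions of the medium and the short edges.\<close>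

definition pm_error :: "nat \<Rightarrow> real" where
  "pm_error k = 12800 * 25600 * sqrt ((2399/2400) / (3199/3200)) ^ k
     + 100 / (14/100) * (1.56 / (1.6 * sqrt (49/50))) ^ k"

lemma pm_error_tendsto_0: "pm_error \<longlonglongrightarrow> 0"
proof -
  have "sqrt ((2399/2400) / (3199/3200)) < 1" by (subst real_sqrt_lt_1_iff) simp
  moreover have "1.56 / (1.6 * sqrt (49/50)) < (1::real)"
  proof -
    \<comment> \<open>Enough, since 1.6 * 0.98 = 1.568 > 1.56.\<close>
    have "0.98 < sqrt (49/50 :: real)" by (rule real_less_rsqrt) (simp add: power2_eq_square)
    then show ?thesis by (simp add: divide_less_eq)
  qed
  ultimately have "(\<lambda>k. 12800 * 25600 * sqrt ((2399/2400) / (3199/3200)) ^ k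
     + 100 / (14/100) * (1.56 / (1.6 * sqrt (49/50))) ^ k) \<longlonglongrightarrow> 12800 * 25600 * 0 + 100 / (14/100) * (0::real)"
    by (intro tendsto_intros LIMSEQ_power_zero) auto
  then show ?thesis unfolding pm_error_def by simp
qed

lemma ex_short_matching:
  assumes k: "1 \<le> k" and X: "finite X" "even (card X)" "X \<subseteq> unit_cube k"
  shows "\<exists>E. perfect_matching X E \<and> edge_sum k E \<le> (1 + pm_error k) * sqrt (real k) ^ k"
proof -
  define f where "f a b = nsq k (\<lambda>t. a t - b t)" for a b :: point
  have sym: "f a b = f b a" for a b unfolding f_def by (rule nsq_minus_commute)
  obtain E where E: "perfect_matching X E"
    and opt: "\<And>a b c d. \<lbrakk>{a, b} \<in> E; {c, d} \<in> E; {a, b} \<noteq> {c, d}\<rbrakk> \<Longrightarrow> f a b + f c d \<le> f a c + f b d"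
    using ex_perfect_matching_two_opt[where f = f and X = X, OF sym X(1,2)] by blast
  have finE: "finite E" using E X(1)
    by (intro finite_subset[of E "Pow X"]) (auto simp: perfect_matching_def complete_edges_def)
  have "\<exists>a b. e = {a, b} \<and> a \<noteq> b \<and> a \<in> unit_cube k \<and> b \<in> unit_cube k" if "e \<in> E" for e
  proof -
    have "e \<subseteq> X" "card e = 2" using E that by (auto simp: perfect_matching_def complete_edges_def)
    then show ?thesis using X(3) by (auto simp: card_2_iff)
  qed
  then obtain A B where AB: "\<And>e. e \<in> E \<Longrightarrow> e = {A e, B e}" "\<And>e. e \<in> E \<Longrightarrow> A e \<noteq> B e"
      "\<And>e. e \<in> E \<Longrightarrow> A e \<in> unit_cube k" "\<And>e. e \<in> E \<Longrightarrow> B e \<in> unit_cube k"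
    by metis
  define m where "m e = mid (A e) (B e)" for e
  define u where "u e = half (A e) (B e)" for e
  interpret matching_family k E m u
  proof
    show "1 \<le> k" by (rule k)
    show "finite E" by (rule finE)
    show "0 < nsq k (u e)" if "e \<in> E" for e
      unfolding u_def using that AB by (intro nsq_half_pos) auto
    show "nsq k (m e) + nsq k (u e) \<le> real k / 4" if "e \<in> E" for e
      unfolding m_def u_def using that AB by (intro mid_half_in_ball) auto
    show "\<bar>m e t\<bar> \<le> 1/2" if "e \<in> E" "t < k" for e t
      unfolding m_def using that AB by (intro abs_mid_le) auto
    fix e g assume eg: "e \<in> E" "g \<in> E" "e \<noteq> g"
    have "f (A e) (B e) + f (A g) (B g) \<le> f (A e) (A g) + f (B e) (B g)"
      by (rule opt) (use eg AB(1) in metis)+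
    then show "nsq k (\<lambda>t. u e t + u g t) \<le> nsq k (\<lambda>t. m e t - m g t)"
      unfolding f_def m_def u_def by (rule two_opt_midpoints)
    \<comment> \<open>The other exchange, with the endpoints of \<open>g\<close> interchanged. It
      fixes the midpoint of \<open>g\<close> and negates its half vector.\<close>
    have "f (A e) (B e) + f (B g) (A g) \<le> f (A e) (B g) + f (B e) (A g)"
      by (rule opt) (use eg AB(1) insert_commute in metis)+
    then have "nsq k (\<lambda>t. half (A e) (B e) t + half (B g) (A g) t) \<le> nsq k (\<lambda>t. mid (A e) (B e) t - mid (B g) (A g) t)"
      unfolding f_def by (rule two_opt_midpoints)
    moreover have "(\<lambda>t. half (A e) (B e) t + half (B g) (A g) t) = (\<lambda>t. u e t - u g t)"
      by (auto simp: u_def half_def field_simps)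
    ultimately show "nsq k (\<lambda>t. u e t - u g t) \<le> nsq k (\<lambda>t. m e t - m g t)"
      by (simp only: m_def mid_commute[of "B g"])
  qed
  have length: "edge_length k e = 2 * r e" if "e \<in> E" for e
  proof -
    have "edge_length k e = edge_length k {A e, B e}" by (rule arg_cong[OF AB(1)[OF that]])
    also have "\<dots> = 2 * r e" unfolding u_def by (simp add: euclid_dist_half)
    finally show ?thesis .
  qed
  have "edge_sum k E = (\<Sum>e\<in>E. (2 * r e) ^ k)"
    unfolding edge_sum_def by (rule sum.cong[OF refl]) (simp only: length)
  also have "\<dots> \<le> (1 + pm_error k) * sqrt (real k) ^ k"
    using sum_power_le_asymp by (simp only: pm_error_def add.assoc)
  finally show ?thesis using E by blast
qed

section \<open>The lower bound and the theorem\<close>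

text \<open>Two opposite vertices of the cube admit only one perfect matching, a diagonal of length
  sqrt k.\<close>

lemma PM_min_diagonal:
  assumes k: "1 \<le> k"
  defines "X \<equiv> {\<lambda>i\<in>{..<k}. 0, \<lambda>i\<in>{..<k}. 1 :: real}"
  shows "X \<subseteq> unit_cube k" "card X = 2" "PM_min k X = sqrt (real k) ^ k"
proof -
  let ?a = "\<lambda>i\<in>{..<k}. 0 :: real" and ?b = "\<lambda>i\<in>{..<k}. 1 :: real"
  show "X \<subseteq> unit_cube k" by (auto simp: X_def unit_cube_def)
  have "?a 0 \<noteq> ?b 0" using k by simp
  then have "?a \<noteq> ?b" by metis
  then show card: "card X = 2" by (simp add: X_def)
  have dist: "euclid_dist k ?a ?b = sqrt (real k)"
    by (simp add: euclid_dist_nsq nsq_def)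
  have only: "E = {X}" if E: "perfect_matching X E" for E
  proof -
    have "e = X" if "e \<in> E" for e
    proof -
      have "e \<subseteq> X" "card e = card X" using E that card by (auto simp: perfect_matching_def complete_edges_def)
      then show ?thesis using card by (metis card_subset_eq card.infinite zero_neq_numeral)
    qed
    moreover have "\<exists>e. e \<in> E" using E by (auto simp: perfect_matching_def X_def)
    ultimately show ?thesis by blast
  qed
  have "perfect_matching X {X}"
    unfolding perfect_matching_def complete_edges_def using card by simp blast
  then have "{E. perfect_matching X E} = {{X}}" using only by blast
  then show "PM_min k X = sqrt (real k) ^ k"
    unfolding PM_min_def by (simp add: edge_sum_def) (simp add: X_def dist)
qed

lemma powr_half_eq: "1 \<le> k \<Longrightarrow> real k powr (real k / 2) = sqrt (real k) ^ k"
  by (simp add: powr_half_sqrt[symmetric] powr_realpow[symmetric] powr_powr)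

lemma HP_ST_sup_le:
  assumes k: "1 \<le> k"
  shows "HP_sup k \<le> ereal (2 * exp 1 * (real k + 1) * sqrt (real k) ^ k)"
    and "ST_sup k \<le> ereal (2 * exp 1 * (real k + 1) * sqrt (real k) ^ k)"
proof -
  have "HP_min k X \<le> 2 * exp 1 * (real k + 1) * sqrt (real k) ^ k \<and>
      ST_min k X \<le> 2 * exp 1 * (real k + 1) * sqrt (real k) ^ k"
    if X: "finite X" "X \<subseteq> unit_cube k" for X
  proof -
    obtain xs where xs: "distinct xs" "set xs = X"
      "edge_sum k (path_edges xs) \<le> 2 * exp 1 * (real k + 1) * sqrt (real k) ^ k"
      using ex_short_path[OF k X] by blast
    then show ?thesis
      using HP_min_le[OF X(1) hamiltonian_path_edges[OF xs(1,2)], of k]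
        ST_min_le[OF X(1) spanning_tree_path_edges[OF xs(1,2)], of k] by linarith
  qed
  then show "HP_sup k \<le> ereal (2 * exp 1 * (real k + 1) * sqrt (real k) ^ k)"
    "ST_sup k \<le> ereal (2 * exp 1 * (real k + 1) * sqrt (real k) ^ k)"
    unfolding HP_sup_def ST_sup_def by (auto intro!: SUP_least)
qed

lemma PM_sup_bounds:
  assumes k: "1 \<le> k"
  shows "ereal (sqrt (real k) ^ k) \<le> PM_sup k"
    and "PM_sup k \<le> ereal ((1 + pm_error k) * sqrt (real k) ^ k)"
proof -
  note diag = PM_min_diagonal[OF k]
  show "ereal (sqrt (real k) ^ k) \<le> PM_sup k"
    unfolding PM_sup_def diag(3)[symmetric]
    by (rule SUP_upper) (use diag(1,2) in auto)
  have "PM_min k X \<le> (1 + pm_error k) * sqrt (real k) ^ k"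
    if X: "finite X" "even (card X)" "X \<subseteq> unit_cube k" for X
    using ex_short_matching[OF k X] PM_min_le[OF X(1)] by (meson order_trans)
  then show "PM_sup k \<le> ereal ((1 + pm_error k) * sqrt (real k) ^ k)"
    unfolding PM_sup_def by (auto intro!: SUP_least)
qed

theorem corollary1p10:
  shows "(\<forall>k::nat. k \<ge> 1 \<longrightarrow>
            HP_sup k \<le> ereal (2 * exp 1 * (real k + 1) * real k powr (real k / 2)) \<and>
            ST_sup k \<le> ereal (2 * exp 1 * (real k + 1) * real k powr (real k / 2))) \<and>
         ((\<lambda>k::nat. PM_sup k / ereal (real k powr (real k / 2))) \<longlonglongrightarrow> 1)"
proof (intro conjI allI impI)
  fix k :: nat assume k: "k \<ge> 1"
  show "HP_sup k \<le> ereal (2 * exp 1 * (real k + 1) * real k powr (real k / 2))"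
    "ST_sup k \<le> ereal (2 * exp 1 * (real k + 1) * real k powr (real k / 2))"
    unfolding powr_half_eq[OF k] by (fact HP_ST_sup_le[OF k])+
next
  let ?q = "\<lambda>k. PM_sup k / ereal (real k powr (real k / 2))"
  \<comment> \<open>The divisor is a positive real, so division in the extended reals preserves both
    bounds and cancels.\<close>
  have bounds: "1 \<le> ?q k \<and> ?q k \<le> ereal (1 + pm_error k)" if k: "1 \<le> k" for k
  proof -
    have pos: "0 < sqrt (real k) ^ k" using k by simp
    have "ereal (sqrt (real k) ^ k) / ereal (sqrt (real k) ^ k) \<le> PM_sup k / ereal (sqrt (real k) ^ k)"
      by (rule ereal_divide_right_mono[OF PM_sup_bounds(1)[OF k]]) (use pos in simp)
    moreover have "PM_sup k / ereal (sqrt (real k) ^ k) \<le>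
        ereal ((1 + pm_error k) * sqrt (real k) ^ k) / ereal (sqrt (real k) ^ k)"
      by (rule ereal_divide_right_mono[OF PM_sup_bounds(2)[OF k]]) (use pos in simp)
    ultimately show ?thesis unfolding powr_half_eq[OF k] using pos k by simp
  qed
  show "?q \<longlonglongrightarrow> 1"
  proof (rule tendsto_sandwich[of "\<lambda>_. 1" _ _ "\<lambda>k. ereal (1 + pm_error k)"])
    show "\<forall>\<^sub>F k in sequentially. 1 \<le> ?q k"
      using bounds by (intro eventually_sequentiallyI[of 1]) blast
    show "\<forall>\<^sub>F k in sequentially. ?q k \<le> ereal (1 + pm_error k)"
      using bounds by (intro eventually_sequentiallyI[of 1]) blast
    have "(\<lambda>k. 1 + pm_error k) \<longlonglongrightarrow> 1 + 0"
      by (intro tendsto_intros pm_error_tendsto_0)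
    then show "(\<lambda>k. ereal (1 + pm_error k)) \<longlonglongrightarrow> 1"
      by (simp add: one_ereal_def)
  qed simp
qed

end
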